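(* Let $F$ be a surface of genus $g\ge0$ with $s\ge1$ punctures, $2g-2+s>0$, and let $\tau\subset F$ be a trivalent fatgraph of $F$ with orientation $o$. Let $C(F,\tau)=\tilde C(F,o,\tau)/\sim$ be the quotient of the coordinate system $\tilde C(F,o,\tau)$ by the equivalences provided by edge reversal and vertex rescalings. Then $C(F,\tau)$ is in bijection with the moduli space $\mathrm{M}_{GL(1|1)}(\tau)$ of gauge equivalence classes of $GL(1|1)$-graph connections on $\tau$.
   Context: Grassmann algebra: let $\mathbb{R}^{S[N]}=\mathbb{R}^{S[N]}_0\oplus\mathbb{R}^{S[N]}_1$ be the real Grassmann algebra on $N$ anticommuting generators, with its even/odd decomposition. The body of an element is its coefficient of $1$; inequalities such as "$x>0$" (positive) are taken to be inequalities on the body. Even elements are denoted by Latin letters, odd elements by Greek letters. $GL(1|1)$ denotes the (identity component) group of supermatrices $\begin{pmatrix} a&\alpha\\ \beta&b\end{pmatrix}$ with $a,b\in\mathbb{R}^{S[N]}_0$ of positive body and $\alpha,\beta\in\mathbb{R}^{S[N]}_1$, with the multiplication $$\begin{pmatrix} a&\alpha\\ \beta&b\end{pmatrix}\begin{pmatrix} c&\gamma\\ \delta&d\end{pmatrix}=\begin{pmatrix} ac-\alpha\delta& a\gamma+d\alpha\\ c\beta+d\delta& bd-\beta\gamma\end{pmatrix}.$$ Every element is uniquely of the form $$g(a,b;\alpha,\beta)=a\left(1+\tfrac12 b^2\alpha\beta\right)\begin{pmatrix}1&\alpha\\0&1\end{pmatrix}\begin{pmatrix}b^{-1}&0\\0&b\end{pmatrix}\begin{pmatrix}1&0\\\beta&1\end{pmatrix}$$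 with $a,b$ even of positive body and $\alpha,\beta$ odd (the scalar in front means that multiple of the identity matrix). A fatgraph is a graph with a cyclic ordering of the edges at each vertex; an orientation assigns a direction to each edge. A fatgraph of $F$ is one from which $F$ is reconstructed by fattening the edges and vertices. A $G$-graph connection on $\tau$ assigns to each edge $e$ an orientation and an element $g_e\in G$, so that $g_{\bar e}=g_e^{-1}$ if $\bar e$ is the inverse-oriented edge. Two graph connections $\{g_e\}$, $\{\tilde g_e\}$ are gauge equivalent if there is an assignment $v\mapsto h_v\in G$ for all vertices $v$ of $\tau$ such that $\tilde g_e=h_v^{-1}g_eh_{v'}$, where $e$ starts at $v'$ and ends at $v$. $\mathrm{M}_G(\tau)$ is the space of gauge equivalence classes. $\tilde C(F,o,\tau)$: the coordinate system for $GL(1|1)$-graph connections on $\tau$ (without factoring by gauge equivalences) in which a coordinate vector assigns to every edge of $\tau$, oriented by $o$, an element of $GL(1|1)$, or equivalently an ordered tuple $(a,b;\alpha,\beta)$ in the parametrization $g(a,b;\alpha,\beta)$ above. Edge reversal: two charts $\tilde C(F,o,\tau)$ and $\tilde C(F,\bar o,\tau)$, corresponding to orientations $o$, $\bar o$, are equivalent if the assignments agree on the edges where the orientation is the same, and are related by $(\bar a,\bar b;\bar\alpha,\bar\beta)=(a^{-1},b^{-1};-b^2\alpha,-b^2\beta)$ on the edges where the orientation is reversed. Vertex rescaling: suppose $e_1,e_2,e_3$ are edges oriented towards a vertex $u$ such that $e_i$ has coordinates $(a_i,b_i;\alpha_i,\beta_i)$, $i=1,2,3$. A vertex rescaling at $u$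 is one of the following three coordinate changes, applied to the coordinates of each $e_i$, where $c$ is positive and even and $\gamma$ is odd: (1) $(a_i,b_i;\alpha_i,\beta_i)\mapsto(a_ic^{-1},b_i;\alpha_i,\beta_i)$; (2) $(a_i,b_i;\alpha_i,\beta_i)\mapsto(a_i,b_ic^{-1};c^2\alpha_i,\beta_i)$; (3) $(a_i,b_i;\alpha_i,\beta_i)\mapsto(a_i(1-\tfrac12b_i^2\beta_i\gamma),b_i;\alpha_i-\gamma,\beta_i)$. If $e_1,e_2,e_3$ are oriented away from a vertex $u$, there is also a vertex rescaling at $u$ for odd $\gamma$: (4) $(a_i,b_i;\alpha_i,\beta_i)\mapsto(a_i(1-\tfrac12b_i^2\alpha_i\gamma),b_i;\alpha_i,\beta_i+\gamma)$. The relation $\sim$ is the equivalence relation defined by edge reversal and vertex rescalings.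
   Formalization: The lower-left entry of the GL(1|1) product is corrected from cβ+dδ, under which the identity matrix is not a left identity, to cβ+bδ; a vertex rescaling at a vertex with a loop is applied once at each end of the loop. *)

theory Defs
  imports
    Complex_Main
    "HOL-Library.FuncSet"
    "HOL-Combinatorics.Permutations"
    "HOL-Combinatorics.Orbits"
    "HOL-Algebra.Group"
begin

section \<open>Real Grassmann algebras\<close>

text \<open>
  The type \<open>grass\<close> is the real Grassmann algebra on countably many anticommuting generators
  \<open>\<theta>\<^sub>0, \<theta>\<^sub>1, \<dots>\<close>. An element is its finitely supported coefficient function with respect to
  the basis \<open>\<theta>\<^sub>S\<close>, the product of the \<open>\<theta>\<^sub>i\<close> with \<open>i \<in> S\<close> in increasing order, where \<open>S\<close> is a
  finite set. The Grassmann algebra on \<open>N\<close> generators is the subalgebra of the elements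
  supported on the subsets of \<open>{..<N}\<close>; working in a common ambient algebra allows \<open>N\<close> to be an
  ordinary variable.
\<close>

typedef grass = "{f :: nat set \<Rightarrow> real. finite {S. f S \<noteq> 0} \<and> (\<forall>S. f S \<noteq> 0 \<longrightarrow> finite S)}"
  morphisms coeff Abs_grass
  by (rule exI[of _ "\<lambda>_. 0"]) simp

setup_lifting type_definition_grass

lemma grass_eqI: "(\<And>S. finite S \<Longrightarrow> coeff x S = coeff y S) \<Longrightarrow> x = y"
  using coeff[of x] coeff[of y]
  by (subst coeff_inject[symmetric], intro ext) (metis (mono_tags, lifting) mem_Collect_eq)

text \<open>
  For disjoint \<open>S\<close> and \<open>T\<close>, \<open>\<theta>\<^sub>S \<theta>\<^sub>T = theta_sign S T \<cdot> \<theta>\<^bsub>S \<union> T\<^esub>\<close>; the exponent counts the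
  transpositions needed to sort the product.
\<close>
definition theta_sign :: "nat set \<Rightarrow> nat set \<Rightarrow> real" where
  "theta_sign S T = (- 1) ^ card {(i, j). i \<in> S \<and> j \<in> T \<and> j < i}"

lemma theta_sign_empty [simp]: "theta_sign {} T = 1" "theta_sign S {} = 1"
  by (simp_all add: theta_sign_def)

lemma finite_inversions:
  "finite S \<Longrightarrow> finite T \<Longrightarrow> finite {(i, j). i \<in> S \<and> j \<in> T \<and> (j::nat) < i}"
  by (rule finite_subset[of _ "S \<times> T"]) auto

lemma theta_sign_Un_left:
  assumes "finite A" "finite B" "finite C" "A \<inter> B = {}"
  shows "theta_sign (A \<union> B) C = theta_sign A C * theta_sign B C"
proof -
  have "{(i, j). i \<in> A \<union> B \<and> j \<in> C \<and> j < i} =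
      {(i, j). i \<in> A \<and> j \<in> C \<and> j < i} \<union> {(i, j). i \<in> B \<and> j \<in> C \<and> j < i}" by auto
  moreover have "{(i, j). i \<in> A \<and> j \<in> C \<and> j < i} \<inter> {(i, j). i \<in> B \<and> j \<in> C \<and> j < i} = {}"
    using assms by auto
  ultimately show ?thesis
    using assms by (simp add: theta_sign_def card_Un_disjoint finite_inversions power_add)
qed

lemma theta_sign_Un_right:
  assumes "finite A" "finite B" "finite C" "B \<inter> C = {}"
  shows "theta_sign A (B \<union> C) = theta_sign A B * theta_sign A C"
proof -
  have "{(i, j). i \<in> A \<and> j \<in> B \<union> C \<and> j < i} =
      {(i, j). i \<in> A \<and> j \<in> B \<and> j < i} \<union> {(i, j). i \<in> A \<and> j \<in> C \<and> j < i}" by auto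
  moreover have "{(i, j). i \<in> A \<and> j \<in> B \<and> j < i} \<inter> {(i, j). i \<in> A \<and> j \<in> C \<and> j < i} = {}"
    using assms by auto
  ultimately show ?thesis
    using assms by (simp add: theta_sign_def card_Un_disjoint finite_inversions power_add)
qed

instantiation grass :: ab_group_add
begin

lift_definition zero_grass :: grass is "\<lambda>_. 0" by simp

lift_definition plus_grass :: "grass \<Rightarrow> grass \<Rightarrow> grass" is "\<lambda>f g S. f S + g S"
proof (intro conjI)
  fix f g :: "nat set \<Rightarrow> real"
  assume f: "finite {S. f S \<noteq> 0} \<and> (\<forall>S. f S \<noteq> 0 \<longrightarrow> finite S)"
    and g: "finite {S. g S \<noteq> 0} \<and> (\<forall>S. g S \<noteq> 0 \<longrightarrow> finite S)"
  show "finite {S. f S + g S \<noteq> 0}"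
    by (rule finite_subset[of _ "{S. f S \<noteq> 0} \<union> {S. g S \<noteq> 0}"]) (use f g in auto)
  show "\<forall>S. f S + g S \<noteq> 0 \<longrightarrow> finite S" using f g by (metis add_0)
qed

lift_definition uminus_grass :: "grass \<Rightarrow> grass" is "\<lambda>f S. - f S" by simp

definition minus_grass :: "grass \<Rightarrow> grass \<Rightarrow> grass" where "minus_grass x y = x + - y"

lemma coeff_zero [simp]: "coeff 0 S = 0" by transfer simp
lemma coeff_add [simp]: "coeff (x + y) S = coeff x S + coeff y S" by transfer simp
lemma coeff_uminus [simp]: "coeff (- x) S = - coeff x S" by transfer simp

instance
proof
  fix x y z :: grass
  show "x + y + z = x + (y + z)" by (rule grass_eqI) simp
  show "x + y = y + x" by (rule grass_eqI) simp
  show "0 + x = x" by (rule grass_eqI) simp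
  show "- x + x = 0" by (rule grass_eqI) simp
  show "x - y = x + - y" by (simp add: minus_grass_def)
qed

end

instantiation grass :: ring_1
begin

lift_definition one_grass :: grass is "\<lambda>S. if S = {} then 1 else 0" by simp

lift_definition times_grass :: "grass \<Rightarrow> grass \<Rightarrow> grass"
  is "\<lambda>f g S. if finite S then \<Sum>T\<in>Pow S. theta_sign T (S - T) * f T * g (S - T) else 0"
proof (intro conjI)
  fix f g :: "nat set \<Rightarrow> real"
  assume f: "finite {S. f S \<noteq> 0} \<and> (\<forall>S. f S \<noteq> 0 \<longrightarrow> finite S)"
    and g: "finite {S. g S \<noteq> 0} \<and> (\<forall>S. g S \<noteq> 0 \<longrightarrow> finite S)"
  let ?h = "\<lambda>S. if finite S then \<Sum>T\<in>Pow S. theta_sign T (S - T) * f T * g (S - T) else 0"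
  have "{S. ?h S \<noteq> 0} \<subseteq> (\<lambda>(A, B). A \<union> B) ` ({S. f S \<noteq> 0} \<times> {S. g S \<noteq> 0})"
  proof
    fix S assume "S \<in> {S. ?h S \<noteq> 0}"
    then have "(\<Sum>T\<in>Pow S. theta_sign T (S - T) * f T * g (S - T)) \<noteq> 0"
      by (auto split: if_splits)
    then obtain T where "T \<in> Pow S" "theta_sign T (S - T) * f T * g (S - T) \<noteq> 0"
      by (meson sum.not_neutral_contains_not_neutral)
    then show "S \<in> (\<lambda>(A, B). A \<union> B) ` ({S. f S \<noteq> 0} \<times> {S. g S \<noteq> 0})"
      by (intro image_eqI[of _ _ "(T, S - T)"]) auto
  qed
  then show "finite {S. ?h S \<noteq> 0}"
    by (rule finite_subset) (use f g in auto)
  show "\<forall>S. ?h S \<noteq> 0 \<longrightarrow> finite S" by auto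
qed

lemma coeff_one: "coeff 1 S = (if S = {} then 1 else 0)" by transfer simp

lemma coeff_times:
  "finite S \<Longrightarrow> coeff (x * y) S = (\<Sum>T\<in>Pow S. theta_sign T (S - T) * coeff x T * coeff y (S - T))"
  by transfer simp

lemma coeff_times_assoc:
  assumes S: "finite S"
  shows "coeff (x * y * z) S = coeff (x * (y * z)) S"
proof -
  let ?F = "\<lambda>A B C. theta_sign A B * theta_sign A C * theta_sign B C *
    coeff x A * coeff y B * coeff z C"
  have "coeff (x * y * z) S = (\<Sum>T\<in>Pow S. \<Sum>A\<in>Pow T. ?F A (T - A) (S - T))"
  proof -
    have "coeff (x * y * z) S = (\<Sum>T\<in>Pow S. theta_sign T (S - T) *
        (\<Sum>A\<in>Pow T. theta_sign A (T - A) * coeff x A * coeff y (T - A)) * coeff z (S - T))"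
      using S by (auto simp: coeff_times finite_subset intro!: sum.cong)
    also have "\<dots> = (\<Sum>T\<in>Pow S. \<Sum>A\<in>Pow T. ?F A (T - A) (S - T))"
    proof (rule sum.cong[OF refl])
      fix T assume T: "T \<in> Pow S"
      have "theta_sign T (S - T) = theta_sign A (S - T) * theta_sign (T - A) (S - T)"
        if "A \<in> Pow T" for A
      proof -
        have "A \<union> (T - A) = T" using that by auto
        then show ?thesis
          using theta_sign_Un_left[of A "T - A" "S - T"] that T S
          by (auto simp: finite_subset)
      qed
      then show "theta_sign T (S - T) *
          (\<Sum>A\<in>Pow T. theta_sign A (T - A) * coeff x A * coeff y (T - A)) * coeff z (S - T) =
          (\<Sum>A\<in>Pow T. ?F A (T - A) (S - T))"
        unfolding sum_distrib_left sum_distrib_right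
        by (intro sum.cong) (auto simp: mult_ac)
    qed
    finally show ?thesis .
  qed
  also have "\<dots> = (\<Sum>(T, A)\<in>(SIGMA T:Pow S. Pow T). ?F A (T - A) (S - T))"
    using S by (subst sum.Sigma) (auto simp: finite_subset)
  also have "\<dots> = (\<Sum>(A, B)\<in>(SIGMA A:Pow S. Pow (S - A)). ?F A B (S - A - B))"
  proof (rule sum.reindex_bij_witness[of _ "\<lambda>(A, B). (A \<union> B, A)" "\<lambda>(T, A). (A, T - A)"], goal_cases)
    case (5 p)
    obtain T A where p: "p = (T, A)" by (cases p)
    have "S - A - (T - A) = S - T" using 5 unfolding p by auto
    then show ?case unfolding p by simp
  qed auto
  also have "\<dots> = (\<Sum>A\<in>Pow S. \<Sum>B\<in>Pow (S - A). ?F A B (S - A - B))"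
    using S by (subst sum.Sigma) (auto simp: finite_subset)
  also have "\<dots> = coeff (x * (y * z)) S"
  proof -
    have "coeff (x * (y * z)) S = (\<Sum>A\<in>Pow S. theta_sign A (S - A) * coeff x A *
        (\<Sum>B\<in>Pow (S - A). theta_sign B (S - A - B) * coeff y B * coeff z (S - A - B)))"
      using S by (auto simp: coeff_times finite_subset intro!: sum.cong)
    also have "\<dots> = (\<Sum>A\<in>Pow S. \<Sum>B\<in>Pow (S - A). ?F A B (S - A - B))"
    proof (rule sum.cong[OF refl])
      fix A assume A: "A \<in> Pow S"
      have "theta_sign A (S - A) = theta_sign A B * theta_sign A (S - A - B)"
        if "B \<in> Pow (S - A)" for B
      proof -
        have "B \<union> (S - A - B) = S - A" using that by auto
        then show ?thesis
          using theta_sign_Un_right[of A B "S - A - B"] that A S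
          by (auto simp: finite_subset)
      qed
      then show "theta_sign A (S - A) * coeff x A *
          (\<Sum>B\<in>Pow (S - A). theta_sign B (S - A - B) * coeff y B * coeff z (S - A - B)) =
          (\<Sum>B\<in>Pow (S - A). ?F A B (S - A - B))"
        unfolding sum_distrib_left
        by (intro sum.cong) (auto simp: mult_ac)
    qed
    finally show ?thesis ..
  qed
  finally show ?thesis .
qed

instance
proof
  fix x y z :: grass
  show "x * y * z = x * (y * z)" by (intro grass_eqI coeff_times_assoc)
  show "1 * x = x"
  proof (rule grass_eqI)
    fix S :: "nat set" assume S: "finite S"
    have "coeff (1 * x) S = (\<Sum>T\<in>Pow S. if T = {} then coeff x S else 0)"
      unfolding coeff_times[OF S] by (intro sum.cong) (auto simp: coeff_one)
    then show "coeff (1 * x) S = coeff x S" using S by (simp add: sum.delta)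
  qed
  show "x * 1 = x"
  proof (rule grass_eqI)
    fix S :: "nat set" assume S: "finite S"
    have "coeff (x * 1) S = (\<Sum>T\<in>Pow S. if T = S then coeff x S else 0)"
      unfolding coeff_times[OF S] by (intro sum.cong) (auto simp: coeff_one)
    then show "coeff (x * 1) S = coeff x S" using S by (simp add: sum.delta)
  qed
  show "(x + y) * z = x * z + y * z"
    by (rule grass_eqI) (simp add: coeff_times algebra_simps sum.distrib)
  show "x * (y + z) = x * y + x * z"
    by (rule grass_eqI) (simp add: coeff_times algebra_simps sum.distrib)
  show "(0::grass) \<noteq> 1"
    by (metis coeff_one coeff_zero zero_neq_one)
qed

end

instantiation grass :: real_algebra_1
begin

lift_definition scaleR_grass :: "real \<Rightarrow> grass \<Rightarrow> grass" is "\<lambda>r f S. r * f S"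
  by (auto intro: rev_finite_subset)

lemma coeff_scaleR [simp]: "coeff (r *\<^sub>R x) S = r * coeff x S" by transfer simp

instance
proof
  fix r s :: real and x y :: grass
  show "r *\<^sub>R (x + y) = r *\<^sub>R x + r *\<^sub>R y" by (rule grass_eqI) (simp add: algebra_simps)
  show "(r + s) *\<^sub>R x = r *\<^sub>R x + s *\<^sub>R x" by (rule grass_eqI) (simp add: algebra_simps)
  show "r *\<^sub>R s *\<^sub>R x = (r * s) *\<^sub>R x" by (rule grass_eqI) simp
  show "1 *\<^sub>R x = x" by (rule grass_eqI) simp
  show "r *\<^sub>R x * y = r *\<^sub>R (x * y)"
    by (rule grass_eqI) (simp add: coeff_times sum_distrib_left mult_ac)
  show "x * r *\<^sub>R y = r *\<^sub>R (x * y)"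
    by (rule grass_eqI) (simp add: coeff_times sum_distrib_left mult_ac)
qed

end

text \<open>The two-sided inverse, with value \<open>0\<close> on elements that are not invertible.\<close>

instantiation grass :: inverse
begin

definition inverse_grass :: "grass \<Rightarrow> grass" where
  "inverse_grass x = (if \<exists>y. x * y = 1 \<and> y * x = 1 then THE y. x * y = 1 \<and> y * x = 1 else 0)"

definition divide_grass :: "grass \<Rightarrow> grass \<Rightarrow> grass" where
  "divide_grass x y = x * inverse y"

instance ..

end

lemma grass_inverse_eq:
  fixes x y :: grass
  assumes "x * y = 1" "y * x = 1"
  shows "inverse x = y"
proof -
  have "(THE y. x * y = 1 \<and> y * x = 1) = y"
  proof (intro the_equality conjI assms)
    fix z assume "x * z = 1 \<and> z * x = 1"
    then have "z = (y * x) * z" "y * (x * z) = y" using assms by simp_all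
    then show "z = y" by (simp add: mult.assoc)
  qed
  then show ?thesis using assms by (auto simp: inverse_grass_def)
qed

definition body :: "grass \<Rightarrow> real" where
  "body x = coeff x {}"

definition grass_even :: "nat \<Rightarrow> grass set" where
  "grass_even N = {x. \<forall>S. coeff x S \<noteq> 0 \<longrightarrow> S \<subseteq> {..<N} \<and> even (card S)}"

definition grass_odd :: "nat \<Rightarrow> grass set" where
  "grass_odd N = {x. \<forall>S. coeff x S \<noteq> 0 \<longrightarrow> S \<subseteq> {..<N} \<and> odd (card S)}"

definition grass_pos :: "nat \<Rightarrow> grass set" where
  "grass_pos N = {x \<in> grass_even N. body x > 0}"


section \<open>The group GL(1|1)\<close>

text \<open>\<open>SMat a \<alpha> \<beta> b\<close> is the supermatrix with rows \<open>(a, \<alpha>)\<close> and \<open>(\<beta>, b)\<close>.\<close>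

datatype smat = SMat grass grass grass grass

text \<open>
  The signs in the diagonal entries come from moving the odd entries past each other: this is the
  product of matrices over the opposite of the Grassmann algebra.
\<close>
fun smat_mult :: "smat \<Rightarrow> smat \<Rightarrow> smat" where
  "smat_mult (SMat a \<alpha> \<beta> b) (SMat c \<gamma> \<delta> d) =
    SMat (a * c - \<alpha> * \<delta>) (a * \<gamma> + d * \<alpha>) (c * \<beta> + b * \<delta>) (b * d - \<beta> * \<gamma>)"

fun smat_scale :: "grass \<Rightarrow> smat \<Rightarrow> smat" where
  "smat_scale k (SMat a \<alpha> \<beta> b) = SMat (k * a) (k * \<alpha>) (k * \<beta>) (k * b)"

definition GL11 :: "nat \<Rightarrow> smat monoid" where
  "GL11 N =
    \<lparr>carrier = {SMat a \<alpha> \<beta> b | a \<alpha> \<beta> b.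
       a \<in> grass_pos N \<and> b \<in> grass_pos N \<and> \<alpha> \<in> grass_odd N \<and> \<beta> \<in> grass_odd N},
     mult = smat_mult,
     one = SMat 1 0 0 1\<rparr>"

text \<open>The tuple \<open>(a, b, \<alpha>, \<beta>)\<close> stands for the coordinates \<open>(a, b; \<alpha>, \<beta>)\<close>.\<close>

type_synonym coords = "grass \<times> grass \<times> grass \<times> grass"

definition GL11_coords :: "nat \<Rightarrow> coords set" where
  "GL11_coords N = grass_pos N \<times> grass_pos N \<times> grass_odd N \<times> grass_odd N"

fun GL11_param :: "coords \<Rightarrow> smat" where
  "GL11_param (a, b, \<alpha>, \<beta>) =
    smat_scale (a * (1 + (1/2) *\<^sub>R (b^2 * \<alpha> * \<beta>)))
      (smat_mult (smat_mult (SMat 1 \<alpha> 0 1) (SMat (inverse b) 0 0 b)) (SMat 1 0 \<beta> 1))"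


section \<open>Fatgraphs\<close>

text \<open>
  A fatgraph is given by its set of oriented edges, the map \<open>opp\<close> inverting the orientation, and
  the map \<open>nxt\<close> that sends an oriented edge \<open>e\<close> to the next edge, oriented towards the same vertex,
  in the cyclic ordering at the vertex where \<open>e\<close> ends. So the oriented edges ending at a
  vertex are the half-edges at this vertex, they form a cycle of \<open>nxt\<close>, and a vertex is
  represented by this cycle.
\<close>

record 'e fatgraph =
  oedges :: "'e set"
  opp :: "'e \<Rightarrow> 'e"
  nxt :: "'e \<Rightarrow> 'e"

definition fatgraph :: "'e fatgraph \<Rightarrow> bool" where
  "fatgraph \<tau> \<longleftrightarrow> finite (oedges \<tau>) \<and> opp \<tau> permutes oedges \<tau> \<and> nxt \<tau> permutes oedges \<tau> \<and>
    (\<forall>e\<in>oedges \<tau>. opp \<tau> e \<noteq> e \<and> opp \<tau> (opp \<tau> e) = e)"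

definition target :: "'e fatgraph \<Rightarrow> 'e \<Rightarrow> 'e set" where
  "target \<tau> e = orbit (nxt \<tau>) e"

definition source :: "'e fatgraph \<Rightarrow> 'e \<Rightarrow> 'e set" where
  "source \<tau> e = target \<tau> (opp \<tau> e)"

definition vertices :: "'e fatgraph \<Rightarrow> 'e set set" where
  "vertices \<tau> = target \<tau> ` oedges \<tau>"

definition edges :: "'e fatgraph \<Rightarrow> 'e set set" where
  "edges \<tau> = (\<lambda>e. {e, opp \<tau> e}) ` oedges \<tau>"

text \<open>
  The boundary components of the fattened graph: after following an oriented edge to its target,
  a boundary path leaves along the next edge in the cyclic ordering.
\<close>
definition boundary_cycles :: "'e fatgraph \<Rightarrow> 'e set set" where
  "boundary_cycles \<tau> = orbit (opp \<tau> \<circ> nxt \<tau>) ` oedges \<tau>"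

definition connected_fatgraph :: "'e fatgraph \<Rightarrow> bool" where
  "connected_fatgraph \<tau> \<longleftrightarrow> oedges \<tau> \<noteq> {} \<and>
    (\<forall>e\<in>oedges \<tau>. \<forall>e'\<in>oedges \<tau>. (\<lambda>d d'. d' = opp \<tau> d \<or> d' = nxt \<tau> d)\<^sup>*\<^sup>* e e')"

definition trivalent :: "'e fatgraph \<Rightarrow> bool" where
  "trivalent \<tau> \<longleftrightarrow> (\<forall>v\<in>vertices \<tau>. card v = 3)"

text \<open>
  Fattening \<open>\<tau>\<close> yields the surface of genus \<open>g\<close> with \<open>s\<close> punctures: the punctures are the boundary
  components, and gluing a disc to each of them gives a closed connected oriented surface of
  Euler characteristic \<open>2 - 2g\<close>.
\<close>
definition fatgraph_of_surface :: "nat \<Rightarrow> nat \<Rightarrow> 'e fatgraph \<Rightarrow> bool" where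
  "fatgraph_of_surface g s \<tau> \<longleftrightarrow> fatgraph \<tau> \<and> connected_fatgraph \<tau> \<and>
    card (boundary_cycles \<tau>) = s \<and>
    int (card (vertices \<tau>)) - int (card (edges \<tau>)) + int s = 2 - 2 * int g"

text \<open>An orientation is the set of the oriented edges that it selects.\<close>

definition orientations :: "'e fatgraph \<Rightarrow> 'e set set" where
  "orientations \<tau> = {ori. ori \<subseteq> oedges \<tau> \<and> (\<forall>e\<in>oedges \<tau>. e \<in> ori \<longleftrightarrow> opp \<tau> e \<notin> ori)}"


section \<open>Graph connections\<close>

definition graph_connections :: "('g, 'm) monoid_scheme \<Rightarrow> 'e fatgraph \<Rightarrow> ('e \<Rightarrow> 'g) set" where
  "graph_connections G \<tau> =
    {A \<in> oedges \<tau> \<rightarrow>\<^sub>E carrier G. \<forall>e\<in>oedges \<tau>. A (opp \<tau> e) = inv\<^bsub>G\<^esub> (A e)}"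

definition gauge_equiv ::
  "('g, 'm) monoid_scheme \<Rightarrow> 'e fatgraph \<Rightarrow> (('e \<Rightarrow> 'g) \<times> ('e \<Rightarrow> 'g)) set" where
  "gauge_equiv G \<tau> =
    {(A, A'). A \<in> graph_connections G \<tau> \<and> A' \<in> graph_connections G \<tau> \<and>
      (\<exists>h. h \<in> vertices \<tau> \<rightarrow> carrier G \<and>
        (\<forall>e\<in>oedges \<tau>.
          A' e = inv\<^bsub>G\<^esub> (h (target \<tau> e)) \<otimes>\<^bsub>G\<^esub> A e \<otimes>\<^bsub>G\<^esub> h (source \<tau> e)))}"

definition moduli :: "('g, 'm) monoid_scheme \<Rightarrow> 'e fatgraph \<Rightarrow> ('e \<Rightarrow> 'g) set set" where
  "moduli G \<tau> = graph_connections G \<tau> // gauge_equiv G \<tau>"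


section \<open>Coordinate charts\<close>

definition chart :: "nat \<Rightarrow> 'e set \<Rightarrow> ('e \<Rightarrow> coords) set" where
  "chart N ori = ori \<rightarrow>\<^sub>E GL11_coords N"

definition chart_connection ::
  "nat \<Rightarrow> 'e fatgraph \<Rightarrow> 'e set \<Rightarrow> ('e \<Rightarrow> coords) \<Rightarrow> ('e \<Rightarrow> smat)" where
  "chart_connection N \<tau> ori x =
    (\<lambda>e\<in>oedges \<tau>. if e \<in> ori then GL11_param (x e)
                  else inv\<^bsub>GL11 N\<^esub> (GL11_param (x (opp \<tau> e))))"

fun reverse_coords :: "coords \<Rightarrow> coords" where
  "reverse_coords (a, b, \<alpha>, \<beta>) = (inverse a, inverse b, - (b^2 * \<alpha>), - (b^2 * \<beta>))"

fun rescale1 :: "grass \<Rightarrow> coords \<Rightarrow> coords" where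
  "rescale1 c (a, b, \<alpha>, \<beta>) = (a * inverse c, b, \<alpha>, \<beta>)"

fun rescale2 :: "grass \<Rightarrow> coords \<Rightarrow> coords" where
  "rescale2 c (a, b, \<alpha>, \<beta>) = (a, b * inverse c, c^2 * \<alpha>, \<beta>)"

fun rescale3 :: "grass \<Rightarrow> coords \<Rightarrow> coords" where
  "rescale3 \<gamma> (a, b, \<alpha>, \<beta>) = (a * (1 - (1/2) *\<^sub>R (b^2 * \<beta> * \<gamma>)), b, \<alpha> - \<gamma>, \<beta>)"

fun rescale4 :: "grass \<Rightarrow> coords \<Rightarrow> coords" where
  "rescale4 \<gamma> (a, b, \<alpha>, \<beta>) = (a * (1 - (1/2) *\<^sub>R (b^2 * \<alpha> * \<gamma>)), b, \<alpha>, \<beta> + \<gamma>)"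

definition inward_rescalings :: "nat \<Rightarrow> (coords \<Rightarrow> coords) set" where
  "inward_rescalings N =
    rescale1 ` grass_pos N \<union> rescale2 ` grass_pos N \<union> rescale3 ` grass_odd N"

definition outward_rescalings :: "nat \<Rightarrow> (coords \<Rightarrow> coords) set" where
  "outward_rescalings N = rescale4 ` grass_odd N"

text \<open>
  The coordinate change \<open>f\<close> is applied at \<open>u\<close> once for every end of an edge at \<open>u\<close>. If \<open>e\<close> is not
  a loop, this just means that \<open>f\<close> is applied to the coordinates of \<open>e\<close>. A loop at \<open>u\<close> occurs
  twice among the three edges oriented towards \<open>u\<close>, once with each orientation; so \<open>f\<close> is applied
  to it once in the orientation \<open>e\<close> and once in the reversed orientation.
\<close>
definition rescale_towards ::
  "'e fatgraph \<Rightarrow> 'e set \<Rightarrow> 'e set \<Rightarrow> (coords \<Rightarrow> coords) \<Rightarrow> ('e \<Rightarrow> coords) \<Rightarrow> 'e \<Rightarrow> coords" where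
  "rescale_towards \<tau> ori u f x =
    (\<lambda>e\<in>ori. if target \<tau> e = u
      then if source \<tau> e = u then reverse_coords (f (reverse_coords (f (x e)))) else f (x e)
      else x e)"

definition rescale_away ::
  "'e fatgraph \<Rightarrow> 'e set \<Rightarrow> 'e set \<Rightarrow> (coords \<Rightarrow> coords) \<Rightarrow> ('e \<Rightarrow> coords) \<Rightarrow> 'e \<Rightarrow> coords" where
  "rescale_away \<tau> ori u f x =
    (\<lambda>e\<in>ori. if source \<tau> e = u
      then if target \<tau> e = u then reverse_coords (f (reverse_coords (f (x e)))) else f (x e)
      else x e)"

text \<open>
  A point of a chart is a pair of an orientation and a coordinate vector. In the rules for vertex
  rescalings, the condition on the orientation says that all edges at \<open>u\<close>, except for loops, are
  oriented towards \<open>u\<close>, respectively away from \<open>u\<close>.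
\<close>
inductive chart_step ::
  "nat \<Rightarrow> 'e fatgraph \<Rightarrow> 'e set \<times> ('e \<Rightarrow> coords) \<Rightarrow> 'e set \<times> ('e \<Rightarrow> coords) \<Rightarrow> bool"
  for N \<tau> where
  edge_reversal:
    "chart_step N \<tau> (ori, x) (ori', x')"
    if "ori \<in> orientations \<tau>" "ori' \<in> orientations \<tau>" "x \<in> chart N ori" "x' \<in> chart N ori'"
      "\<And>e. e \<in> ori' \<Longrightarrow> x' e = (if e \<in> ori then x e else reverse_coords (x (opp \<tau> e)))"
| rescaling_towards:
    "chart_step N \<tau> (ori, x) (ori, rescale_towards \<tau> ori u f x)"
    if "ori \<in> orientations \<tau>" "x \<in> chart N ori" "u \<in> vertices \<tau>" "f \<in> inward_rescalings N"
      "\<And>e. e \<in> ori \<Longrightarrow> source \<tau> e = u \<Longrightarrow> target \<tau> e = u"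
| rescaling_away:
    "chart_step N \<tau> (ori, x) (ori, rescale_away \<tau> ori u f x)"
    if "ori \<in> orientations \<tau>" "x \<in> chart N ori" "u \<in> vertices \<tau>" "f \<in> outward_rescalings N"
      "\<And>e. e \<in> ori \<Longrightarrow> target \<tau> e = u \<Longrightarrow> source \<tau> e = u"

definition chart_equiv ::
  "nat \<Rightarrow> 'e fatgraph \<Rightarrow> 'e set \<Rightarrow> (('e \<Rightarrow> coords) \<times> ('e \<Rightarrow> coords)) set" where
  "chart_equiv N \<tau> ori =
    {(x, y). x \<in> chart N ori \<and> y \<in> chart N ori \<and>
      equivclp (chart_step N \<tau>) (ori, x) (ori, y)}"

definition coordinate_space :: "nat \<Rightarrow> 'e fatgraph \<Rightarrow> 'e set \<Rightarrow> ('e \<Rightarrow> coords) set set" where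
  "coordinate_space N \<tau> ori = chart N ori // chart_equiv N \<tau> ori"

end

theory Submission
  imports Defs
begin

text \<open>
  A point of a chart is a graph connection written in coordinates: by the existence and
  uniqueness of the form \<open>g(a, b; \<alpha>, \<beta>)\<close>, the chart of an orientation is in bijection with the set of graph connections
  (\<open>chart_connection_bij\<close>). Under this bijection the coordinate changes become gauge
  transformations, and the theorem says that they generate exactly gauge equivalence.

  The proof rests on the Gauss decomposition of GL(1|1). Every element is uniquely a positive
  scalar times an upper unitriangular, a diagonal and a lower unitriangular matrix; the scalar is
  the square root of a product of two positive elements, and such roots exist uniquely
  because elements of body zero are nilpotent (\<open>pos_sqrt_exists\<close>, \<open>pos_sqrt_unique\<close>). Two facts link
  the decomposition to the coordinate changes:

    \<^item> Reversing the coordinates of an edge inverts the group element (\<open>GL11_param_reverse\<close>). So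
      edge reversal describes the same connection in another orientation.

    \<^item> The three rescalings of edges towards a vertex are left multiplication by the inverse
      of a scalar, a diagonal or an upper unitriangular matrix, and the rescaling of edges away from a
      vertex is right multiplication by a lower unitriangular matrix. So a vertex rescaling is
      a gauge transformation supported at this vertex, with value one of the factors of the
      Gauss decomposition.

  Hence equivalent coordinate vectors give gauge equivalent connections. Conversely, since the
  four kinds of factors generate the group, every gauge transformation supported at a single vertex is
  a composition of rescalings, interspersed with edge reversals that bring the edges into the
  position required (\<open>realizable_single_gauge\<close>), and a gauge transformation of a finite graph is
  a product of such ones (\<open>realizable_gauge_all\<close>).
\<close>

section \<open>Supercommutativity\<close>

text \<open>
  Of the \<open>card S * card T\<close> pairs, each one is an inversion either of \<open>\<theta>\<^sub>S \<theta>\<^sub>T\<close> or of \<open>\<theta>\<^sub>T \<theta>\<^sub>S\<close>.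
\<close>
lemma theta_sign_swap:
  assumes "finite S" "finite T" "S \<inter> T = {}"
  shows "theta_sign S T = (- 1) ^ (card S * card T) * theta_sign T S"
proof -
  let ?I = "{(i, j). i \<in> S \<and> j \<in> T \<and> j < i}" and ?J = "{(i, j). i \<in> T \<and> j \<in> S \<and> j < i}"
  have "?I \<union> prod.swap ` ?J = S \<times> T" "?I \<inter> prod.swap ` ?J = {}"
    using assms by (force intro: linorder_neqE_nat)+
  moreover have "card (prod.swap ` ?J) = card ?J" by (simp add: card_image)
  ultimately have "card S * card T = card ?I + card ?J"
    using card_Un_disjoint[of ?I "prod.swap ` ?J"] assms
    by (simp add: finite_inversions card_cartesian_product)
  then have "(- 1 :: real) ^ (card S * card T) * theta_sign T S = (- 1) ^ (card ?I + (card ?J + card ?J))"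
    unfolding theta_sign_def by (simp add: power_add)
  also have "\<dots> = theta_sign S T"
    by (simp add: theta_sign_def power_add flip: power_mult_distrib)
  finally show ?thesis by simp
qed

text \<open>
  The parities enter only through the sign \<open>\<epsilon>\<close>, so that one computation serves both the even and
  the odd case.
\<close>
lemma supercommute:
  assumes "\<And>S T. coeff x S \<noteq> 0 \<Longrightarrow> coeff y T \<noteq> 0 \<Longrightarrow> (- 1 :: real) ^ (card S * card T) = \<epsilon>"
  shows "x * y = \<epsilon> *\<^sub>R (y * x)"
proof (rule grass_eqI)
  fix S :: "nat set" assume S: "finite S"
  have "coeff (x * y) S = (\<Sum>T\<in>Pow S. \<epsilon> * (theta_sign (S - T) T * coeff y (S - T) * coeff x T))"
    unfolding coeff_times[OF S]
  proof (intro sum.cong refl)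
    fix T assume "T \<in> Pow S"
    then have "theta_sign T (S - T) = (- 1) ^ (card T * card (S - T)) * theta_sign (S - T) T"
      using S by (intro theta_sign_swap) (auto simp: finite_subset)
    then show "theta_sign T (S - T) * coeff x T * coeff y (S - T) =
        \<epsilon> * (theta_sign (S - T) T * coeff y (S - T) * coeff x T)"
      using assms[of T "S - T"] by (cases "coeff x T = 0 \<or> coeff y (S - T) = 0") auto
  qed
  also have "\<dots> = (\<Sum>T\<in>Pow S. \<epsilon> * (theta_sign T (S - T) * coeff y T * coeff x (S - T)))"
    by (rule sum.reindex_bij_witness[of _ "\<lambda>T. S - T" "\<lambda>T. S - T"]) (auto simp: double_diff)
  also have "\<dots> = coeff (\<epsilon> *\<^sub>R (y * x)) S"
    by (simp add: coeff_times[OF S] sum_distrib_left)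
  finally show "coeff (x * y) S = coeff (\<epsilon> *\<^sub>R (y * x)) S" .
qed

lemma grass_even_commute: "x \<in> grass_even N \<Longrightarrow> x * y = y * x"
  using supercommute[of x y 1] by (auto simp: grass_even_def)

lemma grass_even_left_commute: "x \<in> grass_even N \<Longrightarrow> x * (y * z) = y * (x * z)"
  using grass_even_commute[of x N y] by (simp flip: mult.assoc)

lemma grass_odd_anticommute: "x \<in> grass_odd N \<Longrightarrow> y \<in> grass_odd N \<Longrightarrow> x * y = - (y * x)"
  using supercommute[of x y "-1"] by (auto simp: grass_odd_def)

lemma grass_odd_left_anticommute: "x \<in> grass_odd N \<Longrightarrow> y \<in> grass_odd N \<Longrightarrow> x * (y * z) = - (y * (x * z))"
  using grass_odd_anticommute[of x N y] by (metis mult.assoc mult_minus_left)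

lemma grass_odd_square:
  assumes "x \<in> grass_odd N" shows "x * x = 0"
proof -
  have "coeff (x * x) S = - coeff (x * x) S" for S
    using grass_odd_anticommute[OF assms assms] by (metis coeff_uminus)
  then show ?thesis by (intro grass_eqI) (metis coeff_zero equal_neg_zero)
qed

lemma grass_odd_left_square: "x \<in> grass_odd N \<Longrightarrow> x * (x * z) = 0"
  using grass_odd_square[of x N] by (metis mult.assoc mult_zero_left)

lemma coeff_times_nonzero:
  assumes "coeff (x * y) S \<noteq> 0"
  obtains A B where "coeff x A \<noteq> 0" "coeff y B \<noteq> 0" "S = A \<union> B" "A \<inter> B = {}" "finite A" "finite B"
proof -
  have fin: "finite S" using assms coeff[of "x * y"] by auto
  obtain T where "T \<in> Pow S" "theta_sign T (S - T) * coeff x T * coeff y (S - T) \<noteq> 0"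
    using assms unfolding coeff_times[OF fin] by (meson sum.not_neutral_contains_not_neutral)
  then show ?thesis using fin by (intro that[of T "S - T"]) (auto simp: finite_subset)
qed

lemma grass_even_one: "1 \<in> grass_even N"
  and grass_even_zero: "0 \<in> grass_even N"
  and grass_odd_zero: "0 \<in> grass_odd N"
  and grass_even_uminus: "x \<in> grass_even N \<Longrightarrow> - x \<in> grass_even N"
  and grass_odd_uminus: "x \<in> grass_odd N \<Longrightarrow> - x \<in> grass_odd N"
  and grass_even_scaleR: "x \<in> grass_even N \<Longrightarrow> r *\<^sub>R x \<in> grass_even N"
  by (auto simp: grass_even_def grass_odd_def coeff_one)

lemma coeff_add_nonzero: "coeff (x + y) S \<noteq> 0 \<Longrightarrow> coeff x S \<noteq> 0 \<or> coeff y S \<noteq> 0"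
  by auto

lemma grass_even_add: "x \<in> grass_even N \<Longrightarrow> y \<in> grass_even N \<Longrightarrow> x + y \<in> grass_even N"
  and grass_odd_add: "x \<in> grass_odd N \<Longrightarrow> y \<in> grass_odd N \<Longrightarrow> x + y \<in> grass_odd N"
  unfolding grass_even_def grass_odd_def by (blast dest: coeff_add_nonzero)+

lemma grass_even_diff: "x \<in> grass_even N \<Longrightarrow> y \<in> grass_even N \<Longrightarrow> x - y \<in> grass_even N"
  and grass_odd_diff: "x \<in> grass_odd N \<Longrightarrow> y \<in> grass_odd N \<Longrightarrow> x - y \<in> grass_odd N"
  using grass_even_add[of x N "- y"] grass_odd_add[of x N "- y"] by (auto simp: grass_even_uminus grass_odd_uminus)

lemma grass_even_even_times: "x \<in> grass_even N \<Longrightarrow> y \<in> grass_even N \<Longrightarrow> x * y \<in> grass_even N"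
  and grass_even_odd_times: "x \<in> grass_even N \<Longrightarrow> y \<in> grass_odd N \<Longrightarrow> x * y \<in> grass_odd N"
  and grass_odd_odd_times: "x \<in> grass_odd N \<Longrightarrow> y \<in> grass_odd N \<Longrightarrow> x * y \<in> grass_even N"
proof -
  have split: "\<exists>A B. coeff x A \<noteq> 0 \<and> coeff y B \<noteq> 0 \<and> S = A \<union> B \<and> card S = card A + card B"
    if "coeff (x * y) S \<noteq> 0" for S
    using coeff_times_nonzero[OF that] by (metis card_Un_disjoint)
  show "x \<in> grass_even N \<Longrightarrow> y \<in> grass_even N \<Longrightarrow> x * y \<in> grass_even N"
    and "x \<in> grass_even N \<Longrightarrow> y \<in> grass_odd N \<Longrightarrow> x * y \<in> grass_odd N"
    and "x \<in> grass_odd N \<Longrightarrow> y \<in> grass_odd N \<Longrightarrow> x * y \<in> grass_even N"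
    unfolding grass_even_def grass_odd_def mem_Collect_eq
    by (intro allI impI; drule split; elim exE conjE; simp)+
qed

lemma grass_even_power: "x \<in> grass_even N \<Longrightarrow> x ^ k \<in> grass_even N"
  by (induction k) (auto simp: grass_even_one grass_even_even_times)

lemma grass_even_times_power: "x \<in> grass_even N \<Longrightarrow> (x * y) ^ k = x ^ k * y ^ k"
proof (induction k)
  case (Suc k)
  then show ?case
    by (simp add: mult.assoc grass_even_left_commute[OF grass_even_power[OF Suc.prems], where y = y])
qed simp

section \<open>Inverses and square roots of positive elements\<close>

lemma body_simps:
  "body (x + y) = body x + body y" "body (- x) = - body x" "body (x - y) = body x - body y"
  "body (r *\<^sub>R x) = r * body x" "body 0 = 0" "body 1 = 1" "body (x * y) = body x * body y"
proof -
  have "body (x - y) = body (x + - y)" by simp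
  then show "body (x - y) = body x - body y" unfolding body_def coeff_add by simp
qed (simp_all add: body_def coeff_one coeff_times)

lemma body_power: "body (x ^ k) = body x ^ k"
  by (induction k) (simp_all add: body_simps)

lemma body_odd: "x \<in> grass_odd N \<Longrightarrow> body x = 0"
  by (force simp: body_def grass_odd_def)

text \<open>
  Every factor of body zero contributes at least one generator to each monomial of a product, and
  there are only \<open>N\<close> generators.
\<close>
lemma nilpotent_of_body_zero:
  assumes "x \<in> grass_even N" "body x = 0"
  shows "x ^ Suc N = 0"
proof (rule grass_eqI, rule ccontr)
  fix S assume ne: "coeff (x ^ Suc N) S \<noteq> coeff 0 S"
  have "coeff (x ^ k) T \<noteq> 0 \<Longrightarrow> k \<le> card T" for k T
  proof (induction k arbitrary: T)
    case (Suc k)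
    then obtain A B where AB: "coeff x A \<noteq> 0" "coeff (x ^ k) B \<noteq> 0" "T = A \<union> B" "A \<inter> B = {}"
      "finite A" "finite B" by (auto elim: coeff_times_nonzero)
    then have "A \<noteq> {}" using assms(2) by (auto simp: body_def)
    then have "card A > 0" using AB by (simp add: card_gt_0_iff)
    then show ?case using Suc.IH[OF AB(2)] AB by (simp add: card_Un_disjoint)
  qed simp
  then have "Suc N \<le> card S" using ne by (metis coeff_zero)
  moreover have "S \<subseteq> {..<N}" using ne grass_even_power[OF assms(1), of "Suc N"]
    unfolding grass_even_def by auto
  ultimately show False using card_mono[of "{..<N}" S] by simp
qed

lemma pos_even: "x \<in> grass_pos N \<Longrightarrow> x \<in> grass_even N"
  by (auto simp: grass_pos_def)

lemma pos_one: "1 \<in> grass_pos N"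
  and pos_times: "x \<in> grass_pos N \<Longrightarrow> y \<in> grass_pos N \<Longrightarrow> x * y \<in> grass_pos N"
  and pos_add: "x \<in> grass_pos N \<Longrightarrow> y \<in> grass_pos N \<Longrightarrow> x + y \<in> grass_pos N"
  by (auto simp: grass_pos_def grass_even_one grass_even_even_times grass_even_add body_simps)

lemma pos_add_odd_odd:
  assumes "x \<in> grass_pos N" "y \<in> grass_odd N" "z \<in> grass_odd N"
  shows "x + y * z \<in> grass_pos N" "x - y * z \<in> grass_pos N"
  using assms by (auto simp: grass_pos_def grass_even_add grass_even_diff grass_odd_odd_times body_simps body_odd)

lemma geometric_telescope:
  fixes x :: "'a :: ring_1"
  shows "(1 - x) * (\<Sum>i<k. x ^ i) = 1 - x ^ k"
proof (induction k)
  case (Suc k)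
  have "(1 - x) * (\<Sum>i<Suc k. x ^ i) = (1 - x) * (\<Sum>i<k. x ^ i) + (1 - x) * x ^ k"
    by (simp add: distrib_left)
  then show ?case unfolding Suc.IH by (simp add: left_diff_distrib)
qed simp

text \<open>
  A positive element is its body times \<open>1 - n\<close> with \<open>n\<close> nilpotent, so it is inverted by a finite
  geometric series.
\<close>
lemma pos_has_inverse:
  assumes "x \<in> grass_pos N"
  obtains y where "y \<in> grass_pos N" "x * y = 1"
proof -
  let ?r = "1 / body x" and ?n = "1 - (1 / body x) *\<^sub>R x"
  have pos: "body x > 0" and ev: "x \<in> grass_even N" using assms by (auto simp: grass_pos_def)
  have n: "?n \<in> grass_even N" by (intro grass_even_diff grass_even_one grass_even_scaleR ev)
  have nil: "?n ^ Suc N = 0"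
    using pos by (intro nilpotent_of_body_zero n) (simp add: body_simps)
  define y where "y = ?r *\<^sub>R (\<Sum>i<Suc N. ?n ^ i)"
  have "(\<Sum>i<k. ?n ^ i) \<in> grass_even N" for k
    by (induction k) (simp_all add: grass_even_zero grass_even_add grass_even_power n)
  then have y: "y \<in> grass_even N" unfolding y_def by (intro grass_even_scaleR)
  have "x * y = (1 - ?n) * (\<Sum>i<Suc N. ?n ^ i)"
    unfolding y_def by simp
  then have xy: "x * y = 1" unfolding geometric_telescope nil by simp
  then have "body x * body y = 1" by (metis body_simps(6,7))
  then have "body y > 0" using pos by (metis zero_less_mult_pos zero_less_one)
  then show ?thesis using y xy by (intro that) (auto simp: grass_pos_def)
qed

lemma pos_inverse: "x \<in> grass_pos N \<Longrightarrow> inverse x \<in> grass_pos N"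
  and pos_right_inverse: "x \<in> grass_pos N \<Longrightarrow> x * inverse x = 1"
  and pos_left_inverse: "x \<in> grass_pos N \<Longrightarrow> inverse x * x = 1"
proof -
  assume x: "x \<in> grass_pos N"
  then obtain y where y: "y \<in> grass_pos N" "x * y = 1" by (rule pos_has_inverse)
  moreover from y have "y * x = 1" using grass_even_commute[OF pos_even[OF y(1)], of x] by simp
  ultimately show "inverse x \<in> grass_pos N" "x * inverse x = 1" "inverse x * x = 1"
    using grass_inverse_eq[of x y] by simp_all
qed

lemma pos_inverse_eq: "x \<in> grass_pos N \<Longrightarrow> x * y = 1 \<Longrightarrow> inverse x = y"
  by (metis mult.assoc mult_1_left mult_1_right pos_left_inverse)

lemma pos_inverse_inverse: "x \<in> grass_pos N \<Longrightarrow> inverse (inverse x) = x"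
  by (intro grass_inverse_eq pos_left_inverse pos_right_inverse)

lemma pos_inverse_times:
  assumes "x \<in> grass_pos N" "y \<in> grass_pos N"
  shows "inverse (x * y) = inverse x * inverse y"
proof (rule pos_inverse_eq)
  have "x * y * (inverse x * inverse y) = (x * inverse x) * (y * inverse y)"
    by (simp add: mult.assoc grass_even_left_commute[OF pos_even[OF assms(2)], of "inverse x"])
  then show "x * y * (inverse x * inverse y) = 1" using assms by (simp add: pos_right_inverse)
qed (use assms in \<open>rule pos_times\<close>)

lemma pos_left_cancel:
  assumes "x \<in> grass_pos N" shows "x * y = x * z \<longleftrightarrow> y = z"
  using pos_left_inverse[OF assms] by (metis mult.assoc mult_1_left)

text \<open>
  Newton's iteration for the square root. A step replaces the error \<open>e = s\<^sup>2 - x\<close> of an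
  approximate root \<open>s\<close> by \<open>(e / 2s)\<^sup>2\<close>, which roughly halves the nilpotency index; when the index has
  come down to \<open>1\<close>, the root is exact.
\<close>
lemma pos_sqrt_refine:
  assumes x: "x \<in> grass_pos N"
  shows "s \<in> grass_pos N \<Longrightarrow> (s * s - x) ^ m = 0 \<Longrightarrow> \<exists>t\<in>grass_pos N. t * t = x"
proof (induction m arbitrary: s rule: less_induct)
  case (less m)
  note s = less.prems(1)
  consider "m = 0" | "m = 1" | "m \<ge> 2" by linarith
  then show ?case
  proof cases
    case 1 then show ?thesis using less.prems(2) by simp
  next
    case 2 then show ?thesis using less.prems(2) s by auto
  next
    case 3
    let ?e = "s * s - x"
    \<comment> \<open>The Newton step is \<open>s \<mapsto> s - e / 2s\<close>.\<close>
    define d where "d = (1/2) *\<^sub>R (inverse s * ?e)"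
    define k where "k = (m + 1) div 2"
    have e: "?e \<in> grass_even N"
      using s x by (intro grass_even_diff grass_even_even_times pos_even)
    have d: "d \<in> grass_even N" unfolding d_def
      by (intro grass_even_scaleR grass_even_even_times pos_even pos_inverse s e)
    have "body ?e = 0"
      using less.prems(2) by (metis body_power body_simps(5) power_eq_0_iff)
    then have "body d = 0" by (simp add: d_def body_simps(4,7))
    then have t: "s - d \<in> grass_pos N"
      using s d by (auto simp: grass_pos_def grass_even_diff body_simps)
    have "s * d = (1/2) *\<^sub>R ((s * inverse s) * ?e)" by (simp add: d_def mult.assoc)
    then have sd: "s * d = (1/2) *\<^sub>R ?e" using s by (simp add: pos_right_inverse)
    have "(s - d) * (s - d) - x = ?e - (s * d + s * d) + d * d"
      using grass_even_commute[OF d, of s] by (simp add: algebra_simps)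
    also have "\<dots> = d * d" unfolding sd by (simp flip: scaleR_left_distrib)
    finally have refined: "(s - d) * (s - d) - x = d * d" .
    have "?e ^ (2 * k) = ?e ^ m * ?e ^ (2 * k - m)"
      unfolding k_def by (simp flip: power_add)
    then have "?e ^ (2 * k) = 0" using less.prems(2) by simp
    moreover have "d = ((1/2) *\<^sub>R inverse s) * ?e" by (simp add: d_def)
    ultimately have "d ^ (2 * k) = 0"
      using grass_even_times_power[OF grass_even_scaleR[OF pos_even[OF pos_inverse[OF s]]],
          where y = ?e and k = "2 * k"] by simp
    then have "(d * d) ^ k = 0" by (simp add: power_mult power2_eq_square)
    moreover have "k < m" using 3 by (simp add: k_def)
    ultimately show ?thesis using less.IH[OF _ t] refined by metis
  qed
qed

lemma pos_sqrt_exists: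
  assumes x: "x \<in> grass_pos N"
  obtains t where "t \<in> grass_pos N" "t * t = x"
proof -
  let ?s = "sqrt (body x) *\<^sub>R 1 :: grass"
  have pos: "body x > 0" and ev: "x \<in> grass_even N" using x by (auto simp: grass_pos_def)
  have s: "?s \<in> grass_pos N" using pos
    by (simp add: grass_pos_def grass_even_scaleR grass_even_one body_simps)
  have "(?s * ?s - x) ^ Suc N = 0"
    using pos by (intro nilpotent_of_body_zero grass_even_diff grass_even_even_times pos_even s ev) (simp add: body_simps)
  then show ?thesis using pos_sqrt_refine[OF x s] that by blast
qed

text \<open>
  From \<open>s\<^sup>2 = t\<^sup>2\<close> follows \<open>(s + t) (s - t) = 0\<close>, and \<open>s + t\<close> is invertible because both bodies are
  positive.
\<close>
lemma pos_sqrt_unique: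
  assumes "s \<in> grass_pos N" "t \<in> grass_pos N" "s * s = t * t"
  shows "s = t"
proof -
  have "(s + t) * s = (s + t) * t"
    using assms grass_even_commute[OF pos_even[OF assms(1)], of t] by (simp add: algebra_simps)
  then show ?thesis using pos_left_cancel[OF pos_add[OF assms(1,2)]] by blast
qed

section \<open>The group GL(1|1)\<close>

lemmas grass_even_intros =
  grass_even_one grass_even_zero grass_even_uminus grass_even_scaleR grass_even_add grass_even_diff
  grass_even_even_times grass_odd_odd_times grass_even_power

lemmas grass_odd_intros =
  grass_odd_zero grass_odd_uminus grass_odd_add grass_odd_diff grass_even_odd_times

lemma GL11_simps [simp]:
  "mult (GL11 N) = smat_mult" "one (GL11 N) = SMat 1 0 0 1"
  by (simp_all add: GL11_def)

lemma GL11_carrier [simp]: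
  "SMat p q r t \<in> carrier (GL11 N) \<longleftrightarrow>
    p \<in> grass_pos N \<and> q \<in> grass_odd N \<and> r \<in> grass_odd N \<and> t \<in> grass_pos N"
  by (auto simp: GL11_def)

lemma GL11_carrierE:
  assumes "m \<in> carrier (GL11 N)"
  obtains p q r t where "m = SMat p q r t" "p \<in> grass_pos N" "q \<in> grass_odd N"
    "r \<in> grass_odd N" "t \<in> grass_pos N"
  using assms by (cases m) auto

lemma GL11_mult_closed:
  assumes "m \<in> carrier (GL11 N)" "n \<in> carrier (GL11 N)"
  shows "smat_mult m n \<in> carrier (GL11 N)"
  using assms
  by (elim GL11_carrierE) (simp add: pos_add_odd_odd pos_times grass_odd_intros pos_even)

lemma GL11_mult_assoc:
  assumes "l \<in> carrier (GL11 N)" "m \<in> carrier (GL11 N)" "n \<in> carrier (GL11 N)"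
  shows "smat_mult (smat_mult l m) n = smat_mult l (smat_mult m n)"
proof -
  \<comment> \<open>Ordered rewriting with these rules sorts the even factors; the odd ones keep their order.\<close>
  note ac = mult.assoc grass_even_commute[where N = N] grass_even_left_commute[where N = N]
  \<comment> \<open>A product of two odd elements is even, hence may be moved past a third odd element.\<close>
  have odd_odd: "x * (y * z) = z * (x * y)" if "x \<in> grass_odd N" "y \<in> grass_odd N" for x y z
    using grass_even_commute[OF grass_odd_odd_times[OF that], of z] by (simp add: mult.assoc)
  obtain a \<alpha> \<beta> b where l: "l = SMat a \<alpha> \<beta> b" "a \<in> grass_pos N" "\<alpha> \<in> grass_odd N"
    "\<beta> \<in> grass_odd N" "b \<in> grass_pos N" using assms(1) by (rule GL11_carrierE)
  obtain c \<gamma> \<delta> d where m: "m = SMat c \<gamma> \<delta> d" "c \<in> grass_pos N" "\<gamma> \<in> grass_odd N"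
    "\<delta> \<in> grass_odd N" "d \<in> grass_pos N" using assms(2) by (rule GL11_carrierE)
  obtain e \<epsilon> \<zeta> f where n: "n = SMat e \<epsilon> \<zeta> f" "e \<in> grass_pos N" "\<epsilon> \<in> grass_odd N"
    "\<zeta> \<in> grass_odd N" "f \<in> grass_pos N" using assms(3) by (rule GL11_carrierE)
  show ?thesis
    using l m n odd_odd[of \<delta> \<epsilon> \<alpha>] odd_odd[of \<gamma> \<zeta> \<beta>]
    by (simp add: pos_even algebra_simps ac)
qed

subsection \<open>Gauss decomposition\<close>

text \<open>
  The product of the scalar matrix \<open>k\<close>, the upper unitriangular matrix of \<open>\<alpha>\<close>, the diagonal
  matrix with entries \<open>b\<^sup>-\<^sup>1, b\<close> and the lower unitriangular matrix of \<open>\<beta>\<close>. It differs from the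
  parametrization of the charts in having \<open>k\<close> in place of \<open>a (1 + b\<^sup>2 \<alpha> \<beta> / 2)\<close>. In terms of \<open>k\<close> the
  coordinate changes lose their correction factors, while the factor in the chart makes
  inversion look simple; \<open>gauss_coords\<close> translates from \<open>a\<close> to \<open>k\<close>.
\<close>
fun gauss_mat :: "coords \<Rightarrow> smat" where
  "gauss_mat (k, b, \<alpha>, \<beta>) = SMat (k * (inverse b - b * \<alpha> * \<beta>)) (k * b * \<alpha>) (k * b * \<beta>) (k * b)"

fun gauss_coords :: "coords \<Rightarrow> coords" where
  "gauss_coords (a, b, \<alpha>, \<beta>) = (a * (1 + (1/2) *\<^sub>R (b^2 * \<alpha> * \<beta>)), b, \<alpha>, \<beta>)"

fun ungauss_coords :: "coords \<Rightarrow> coords" where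
  "ungauss_coords (k, b, \<alpha>, \<beta>) = (k * (1 - (1/2) *\<^sub>R (b^2 * \<alpha> * \<beta>)), b, \<alpha>, \<beta>)"

lemma GL11_param_eq_gauss: "GL11_param x = gauss_mat (gauss_coords x)"
  by (cases x) (simp add: mult.assoc)

lemma GL11_coords_iff [simp]:
  "(a, b, \<alpha>, \<beta>) \<in> GL11_coords N \<longleftrightarrow>
    a \<in> grass_pos N \<and> b \<in> grass_pos N \<and> \<alpha> \<in> grass_odd N \<and> \<beta> \<in> grass_odd N"
  by (simp add: GL11_coords_def)

lemma pos_times_one_plus_odd_odd:
  assumes "a \<in> grass_pos N" "b \<in> grass_even N" "\<alpha> \<in> grass_odd N" "\<beta> \<in> grass_odd N"
  shows "a * (1 + r *\<^sub>R (b * \<alpha> * \<beta>)) \<in> grass_pos N" "a * (1 - r *\<^sub>R (b * \<alpha> * \<beta>)) \<in> grass_pos N"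
proof -
  have odd: "r *\<^sub>R (b * \<alpha>) \<in> grass_odd N" for r
    using grass_even_odd_times[OF grass_even_scaleR[OF assms(2)] assms(3), of r] by simp
  show "a * (1 + r *\<^sub>R (b * \<alpha> * \<beta>)) \<in> grass_pos N" "a * (1 - r *\<^sub>R (b * \<alpha> * \<beta>)) \<in> grass_pos N"
    using pos_add_odd_odd[OF pos_one odd assms(4), of r] by (auto intro!: pos_times assms(1))
qed

lemma gauss_coords_closed: "x \<in> GL11_coords N \<Longrightarrow> gauss_coords x \<in> GL11_coords N"
  and ungauss_coords_closed: "x \<in> GL11_coords N \<Longrightarrow> ungauss_coords x \<in> GL11_coords N"
  by (cases x; simp add: pos_times_one_plus_odd_odd pos_even grass_even_power)+

lemma soul_square:
  assumes "b \<in> grass_even N" "\<alpha> \<in> grass_odd N" "\<beta> \<in> grass_odd N"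
  shows "(b * \<alpha> * \<beta>) * (b * \<alpha> * \<beta>) = 0"
proof -
  have "(b * \<alpha> * \<beta>) * (b * \<alpha> * \<beta>) = b * (\<alpha> * (\<beta> * (b * (\<alpha> * \<beta>))))" by (simp add: mult.assoc)
  also have "\<dots> = b * (b * (\<alpha> * (\<beta> * (\<alpha> * \<beta>))))"
    using grass_even_left_commute[OF assms(1)] by metis
  also have "\<beta> * (\<alpha> * \<beta>) = - (\<alpha> * (\<beta> * \<beta>))"
    by (rule grass_odd_left_anticommute[OF assms(3,2)])
  finally show ?thesis using grass_odd_square[OF assms(3)] by simp
qed

text \<open>
  The correction \<open>Y = b\<^sup>2 \<alpha> \<beta> / 2\<close> has square zero, so \<open>1 + Y\<close> and \<open>1 - Y\<close> are inverse to each other.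
\<close>
lemma gauss_ungauss:
  assumes "x \<in> GL11_coords N"
  shows "gauss_coords (ungauss_coords x) = x" "ungauss_coords (gauss_coords x) = x"
proof -
  obtain a b \<alpha> \<beta> where x: "x = (a, b, \<alpha>, \<beta>)" by (cases x)
  define Y where "Y = (1/2) *\<^sub>R (b^2 * \<alpha> * \<beta>)"
  have "Y * Y = 0"
    using soul_square[of "b^2" N \<alpha> \<beta>] assms by (simp add: Y_def x pos_even grass_even_power)
  then have "(1 - Y) * (1 + Y) = 1" "(1 + Y) * (1 - Y) = 1" by (simp_all add: algebra_simps)
  then show "gauss_coords (ungauss_coords x) = x" "ungauss_coords (gauss_coords x) = x"
    unfolding x gauss_coords.simps ungauss_coords.simps Y_def[symmetric] by (simp_all add: mult.assoc)
qed

lemma gauss_mat_closed: "x \<in> GL11_coords N \<Longrightarrow> gauss_mat x \<in> carrier (GL11 N)"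
  by (cases x) (simp add: pos_times pos_inverse pos_add_odd_odd grass_odd_intros grass_even_intros pos_even)

text \<open>
  The odd coordinates are quotients of entries by the lower right entry \<open>k b\<close>. Knowing them, one
  recovers \<open>k b\<^sup>-\<^sup>1\<close> from the upper left entry, and \<open>k\<close> is the positive square root of
  \<open>(k b\<^sup>-\<^sup>1) (k b)\<close>.
\<close>
lemma gauss_mat_inj:
  assumes x: "x \<in> GL11_coords N" and y: "y \<in> GL11_coords N" and eq: "gauss_mat x = gauss_mat y"
  shows "x = y"
proof -
  obtain k b \<alpha> \<beta> where x': "x = (k, b, \<alpha>, \<beta>)" by (cases x)
  obtain l c \<gamma> \<delta> where y': "y = (l, c, \<gamma>, \<delta>)" by (cases y)
  have kl: "k \<in> grass_pos N" "l \<in> grass_pos N" and bc: "b \<in> grass_pos N" "c \<in> grass_pos N"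
    using x y by (auto simp: x' y')
  have entries: "k * (inverse b - b * \<alpha> * \<beta>) = l * (inverse c - c * \<gamma> * \<delta>)" "k * b * \<alpha> = l * c * \<gamma>"
    "k * b * \<beta> = l * c * \<delta>" "k * b = l * c" using eq by (auto simp: x' y')
  have odd: "\<alpha> = \<gamma>" "\<beta> = \<delta>"
    using entries pos_left_cancel[OF pos_times[OF kl(2) bc(2)]] by simp_all
  have "k * (b * \<alpha> * \<beta>) = l * (c * \<gamma> * \<delta>)"
    using entries(2) odd by (simp flip: mult.assoc)
  then have diag: "k * inverse b = l * inverse c"
    using entries(1) by (simp add: right_diff_distrib)
  have kk: "(k * inverse b) * (k * b) = k * k"
    if "k \<in> grass_pos N" "b \<in> grass_pos N" for k b
  proof -
    have "inverse b * (k * b) = k * (inverse b * b)"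
      by (rule grass_even_left_commute[OF pos_even[OF pos_inverse[OF that(2)]]])
    then show ?thesis using pos_left_inverse[OF that(2)] by (simp add: mult.assoc)
  qed
  have "k * k = l * l"
    using kk[OF kl(1) bc(1)] kk[OF kl(2) bc(2)] diag entries(4) by simp
  then have "k = l" by (rule pos_sqrt_unique[OF kl])
  then show ?thesis using entries(4) pos_left_cancel[OF kl(2)] odd by (simp add: x' y')
qed

text \<open>
  Elimination, with the same formulas as for injectivity: \<open>w\<close> is the value that \<open>k b\<^sup>-\<^sup>1\<close> must
  have, so \<open>k\<close> has to be a square root of \<open>t w\<close>.
\<close>
lemma gauss_mat_surj:
  assumes "m \<in> carrier (GL11 N)"
  obtains x where "x \<in> GL11_coords N" "gauss_mat x = m"
proof -
  obtain p q r t where m: "m = SMat p q r t" "p \<in> grass_pos N" "q \<in> grass_odd N"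
    "r \<in> grass_odd N" "t \<in> grass_pos N" using assms by (rule GL11_carrierE)
  define \<alpha> \<beta> where "\<alpha> = inverse t * q" and "\<beta> = inverse t * r"
  have odd: "\<alpha> \<in> grass_odd N" "\<beta> \<in> grass_odd N"
    unfolding \<alpha>_def \<beta>_def by (auto intro: grass_even_odd_times pos_even pos_inverse m)
  define w where "w = p + t * \<alpha> * \<beta>"
  have w: "w \<in> grass_pos N" unfolding w_def
    by (intro pos_add_odd_odd grass_even_odd_times pos_even m odd)
  obtain k where k: "k \<in> grass_pos N" "k * k = t * w"
    using pos_sqrt_exists[OF pos_times[OF m(5) w]] .
  define b where "b = inverse k * t"
  have b: "b \<in> grass_pos N" unfolding b_def by (intro pos_times pos_inverse k m)
  have kb: "k * b = t" unfolding b_def using pos_right_inverse[OF k(1)] by (simp flip: mult.assoc)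
  have "inverse b = k * inverse t"
    unfolding b_def using pos_inverse_times[OF pos_inverse[OF k(1)] m(5)] pos_inverse_inverse[OF k(1)] by simp
  then have "k * inverse b = (t * w) * inverse t" using k(2) by (simp flip: mult.assoc)
  also have "\<dots> = w"
    using pos_left_inverse[OF m(5)] grass_even_commute[OF pos_even[OF m(5)], of w]
      pos_right_inverse[OF m(5)] by (simp add: mult.assoc)
  finally have kb': "k * inverse b = w" .
  have "k * (b * \<alpha> * \<beta>) = t * \<alpha> * \<beta>" using kb by (simp flip: mult.assoc)
  moreover have "t * \<alpha> = q" "t * \<beta> = r"
    unfolding \<alpha>_def \<beta>_def using pos_right_inverse[OF m(5)] by (simp_all flip: mult.assoc)
  ultimately have "gauss_mat (k, b, \<alpha>, \<beta>) = m"
    using kb kb' m(1) by (simp add: right_diff_distrib w_def)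
  then show ?thesis using that[of "(k, b, \<alpha>, \<beta>)"] k b odd by simp
qed

lemma GL11_param_bij: "bij_betw GL11_param (GL11_coords N) (carrier (GL11 N))"
proof (rule bij_betw_imageI)
  show "inj_on GL11_param (GL11_coords N)"
    by (rule inj_onI) (metis GL11_param_eq_gauss gauss_coords_closed gauss_mat_inj gauss_ungauss(2))
  show "GL11_param ` GL11_coords N = carrier (GL11 N)"
  proof
    show "GL11_param ` GL11_coords N \<subseteq> carrier (GL11 N)"
      by (auto simp: GL11_param_eq_gauss intro!: gauss_mat_closed gauss_coords_closed simp del: gauss_mat.simps)
    show "carrier (GL11 N) \<subseteq> GL11_param ` GL11_coords N"
    proof
      fix m assume "m \<in> carrier (GL11 N)"
      then obtain x where x: "x \<in> GL11_coords N" "gauss_mat x = m" by (rule gauss_mat_surj)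
      then have "m = GL11_param (ungauss_coords x)"
        by (simp add: GL11_param_eq_gauss gauss_ungauss)
      then show "m \<in> GL11_param ` GL11_coords N" using ungauss_coords_closed[OF x(1)] by blast
    qed
  qed
qed

lemma reverse_coords_closed: "x \<in> GL11_coords N \<Longrightarrow> reverse_coords x \<in> GL11_coords N"
  by (cases x) (simp add: pos_inverse grass_odd_intros grass_even_power pos_even)

text \<open>
  With \<open>Y = b\<^sup>2 \<alpha> \<beta> / 2\<close>, the matrix is \<open>a\<close> times the one with rows \<open>(b\<^sup>-\<^sup>1 (1 - Y), b \<alpha>)\<close> and
  \<open>(b \<beta>, b (1 + Y))\<close>, and reversal leaves \<open>Y\<close> unchanged; so the product can be evaluated directly.
\<close>
lemma reverse_coords_param:
  assumes "x \<in> GL11_coords N"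
  shows "smat_mult (GL11_param (reverse_coords x)) (GL11_param x) = SMat 1 0 0 1"
proof -
  obtain a b \<alpha> \<beta> where x: "x = (a, b, \<alpha>, \<beta>)" by (cases x)
  have a: "a \<in> grass_pos N" and b: "b \<in> grass_pos N" and \<alpha>: "\<alpha> \<in> grass_odd N" and \<beta>: "\<beta> \<in> grass_odd N"
    using assms by (auto simp: x)
  define a1 b1 where "a1 = inverse a" and "b1 = inverse b"
  have ab: "a1 \<in> grass_even N" "b1 \<in> grass_even N" "a \<in> grass_even N" "b \<in> grass_even N"
    using a b by (auto simp: a1_def b1_def pos_inverse pos_even)
  note ac = mult.assoc grass_even_commute[where N = N] grass_even_left_commute[where N = N]
  have inv: "a1 * a = 1" "b1 * b = 1" "inverse b1 = b"
    using a b by (simp_all add: a1_def b1_def pos_left_inverse pos_inverse_inverse)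
  have inv': "a1 * (a * z) = z" "b1 * (b * z) = z" for z
    using inv(1,2) by (simp_all flip: mult.assoc)
  have odd: "\<beta> * \<alpha> = - (\<alpha> * \<beta>)" "\<beta> * (\<alpha> * z) = - (\<alpha> * (\<beta> * z))" "\<alpha> * \<alpha> = 0" "\<beta> * \<beta> = 0"
    "\<alpha> * (\<alpha> * z) = 0" "\<beta> * (\<beta> * z) = 0" for z
    using \<alpha> \<beta> by (simp_all add: grass_odd_square grass_odd_left_square grass_odd_anticommute[of \<beta> N \<alpha>]
        grass_odd_left_anticommute[of \<beta> N \<alpha>])
  show ?thesis
    unfolding x GL11_param_eq_gauss
    by (simp add: power2_eq_square inv flip: a1_def b1_def)
      (simp add: algebra_simps ac ab inv inv' odd flip: scaleR_left_distrib)
qed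

text \<open>
  Inverses exist because every element has coordinates and edge reversal inverts.
\<close>
lemma GL11_group: "group (GL11 N)"
proof (rule groupI)
  fix m assume "m \<in> carrier (GL11 N)"
  then obtain x where x: "x \<in> GL11_coords N" "GL11_param x = m"
    using GL11_param_bij by (metis bij_betw_imp_surj_on imageE)
  then show "\<exists>n\<in>carrier (GL11 N). n \<otimes>\<^bsub>GL11 N\<^esub> m = \<one>\<^bsub>GL11 N\<^esub>"
    using reverse_coords_param[OF x(1)] bij_betw_apply[OF GL11_param_bij reverse_coords_closed[OF x(1)]]
    by (intro bexI[of _ "GL11_param (reverse_coords x)"]) (simp_all del: GL11_param.simps)
next
  fix m assume "m \<in> carrier (GL11 N)"
  then show "\<one>\<^bsub>GL11 N\<^esub> \<otimes>\<^bsub>GL11 N\<^esub> m = m" by (cases m) simp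
qed (auto simp: GL11_mult_closed GL11_mult_assoc pos_one grass_odd_zero)

lemma GL11_param_closed: "x \<in> GL11_coords N \<Longrightarrow> GL11_param x \<in> carrier (GL11 N)"
  using bij_betw_apply[OF GL11_param_bij] .

lemma GL11_param_reverse:
  "x \<in> GL11_coords N \<Longrightarrow> GL11_param (reverse_coords x) = inv\<^bsub>GL11 N\<^esub> (GL11_param x)"
  using group.inv_equality[OF GL11_group] reverse_coords_param reverse_coords_closed GL11_param_closed
  by (metis GL11_simps)

subsection \<open>Coordinate changes as multiplication\<close>

abbreviation scalar_mat :: "grass \<Rightarrow> smat" where "scalar_mat c \<equiv> SMat c 0 0 c"
abbreviation diag_mat :: "grass \<Rightarrow> smat" where "diag_mat c \<equiv> SMat (inverse c) 0 0 c"
abbreviation upper_mat :: "grass \<Rightarrow> smat" where "upper_mat \<gamma> \<equiv> SMat 1 \<gamma> 0 1"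
abbreviation lower_mat :: "grass \<Rightarrow> smat" where "lower_mat \<gamma> \<equiv> SMat 1 0 \<gamma> 1"

lemma GL11_inverses:
  "c \<in> grass_pos N \<Longrightarrow> inv\<^bsub>GL11 N\<^esub> (scalar_mat c) = scalar_mat (inverse c)"
  "c \<in> grass_pos N \<Longrightarrow> inv\<^bsub>GL11 N\<^esub> (diag_mat c) = SMat c 0 0 (inverse c)"
  "\<gamma> \<in> grass_odd N \<Longrightarrow> inv\<^bsub>GL11 N\<^esub> (upper_mat \<gamma>) = upper_mat (- \<gamma>)"
  by (rule group.inv_equality[OF GL11_group];
      simp add: pos_left_inverse pos_right_inverse pos_inverse pos_one grass_odd_zero grass_odd_uminus)+

text \<open>
  The coordinate change \<open>f\<close> is the effect on an edge of a gauge transformation with value \<open>h\<close> at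
  the target (left multiplication by the inverse of \<open>h\<close>) or at the source (right multiplication by
  \<open>h\<close>), and \<open>1\<close> at the other end.
\<close>
definition left_multiplication :: "nat \<Rightarrow> (coords \<Rightarrow> coords) \<Rightarrow> smat \<Rightarrow> bool" where
  "left_multiplication N f h \<longleftrightarrow> (\<forall>x\<in>GL11_coords N. f x \<in> GL11_coords N \<and>
    GL11_param (f x) = inv\<^bsub>GL11 N\<^esub> h \<otimes>\<^bsub>GL11 N\<^esub> GL11_param x)"

definition right_multiplication :: "nat \<Rightarrow> (coords \<Rightarrow> coords) \<Rightarrow> smat \<Rightarrow> bool" where
  "right_multiplication N f h \<longleftrightarrow> (\<forall>x\<in>GL11_coords N. f x \<in> GL11_coords N \<and>
    GL11_param (f x) = GL11_param x \<otimes>\<^bsub>GL11 N\<^esub> h)"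

lemma rescale1_left:
  assumes c: "c \<in> grass_pos N"
  shows "left_multiplication N (rescale1 c) (scalar_mat c)"
  unfolding left_multiplication_def GL11_inverses(1)[OF c]
proof (intro ballI conjI)
  fix x assume x: "x \<in> GL11_coords N"
  obtain a b \<alpha> \<beta> where x': "x = (a, b, \<alpha>, \<beta>)" by (cases x)
  have c1: "inverse c \<in> grass_pos N" by (rule pos_inverse[OF c])
  show "rescale1 c x \<in> GL11_coords N" using x c1 by (simp add: x' pos_times)
  show "GL11_param (rescale1 c x) = scalar_mat (inverse c) \<otimes>\<^bsub>GL11 N\<^esub> GL11_param x"
    using grass_even_commute[OF pos_even[OF c1], of a] by (simp add: x' mult.assoc)
      (simp flip: mult.assoc)
qed

text \<open>
  Moving the diagonal matrix past the upper unitriangular one conjugates the latter, which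
  multiplies \<open>\<alpha>\<close> by \<open>c\<^sup>2\<close>; the product \<open>b\<^sup>2 \<alpha> \<beta>\<close>, and with it the passage from \<open>a\<close> to \<open>k\<close>, is unchanged.
\<close>
lemma rescale2_left:
  assumes c: "c \<in> grass_pos N"
  shows "left_multiplication N (rescale2 c) (diag_mat c)"
  unfolding left_multiplication_def GL11_inverses(2)[OF c]
proof (intro ballI conjI)
  fix x assume x: "x \<in> GL11_coords N"
  obtain a b \<alpha> \<beta> where x': "x = (a, b, \<alpha>, \<beta>)" by (cases x)
  obtain k where k: "gauss_coords x = (k, b, \<alpha>, \<beta>)" by (simp add: x')
  define b1 c1 where "b1 = inverse b" and "c1 = inverse c"
  have ev: "k \<in> grass_even N" "b \<in> grass_even N" "c \<in> grass_even N" "b1 \<in> grass_even N" "c1 \<in> grass_even N"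
    using gauss_coords_closed[OF x] x c unfolding k by (auto simp: x' b1_def c1_def pos_inverse pos_even)
  have inv: "c1 * c = 1" "c1 * (c * z) = z" for z
    using pos_left_inverse[OF c] by (simp_all add: c1_def flip: mult.assoc)
  have binv: "inverse (b * c1) = b1 * c"
    using x c pos_inverse_times[of b N "inverse c"]
    by (simp add: x' b1_def c1_def pos_inverse pos_inverse_inverse[OF c])
  note ac = mult.assoc grass_even_commute[where N = N] grass_even_left_commute[where N = N]
  show "rescale2 c x \<in> GL11_coords N"
    using x c by (simp add: x' pos_times pos_inverse grass_even_odd_times grass_even_power pos_even)
  have "(b * c1)^2 * (c^2 * \<alpha>) * \<beta> = b^2 * \<alpha> * \<beta>"
    by (simp add: power2_eq_square ac ev inv)
  then have "gauss_coords (rescale2 c x) = (k, b * c1, c^2 * \<alpha>, \<beta>)"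
    using k by (simp add: x' flip: c1_def)
  then show "GL11_param (rescale2 c x) = SMat c 0 0 (inverse c) \<otimes>\<^bsub>GL11 N\<^esub> GL11_param x"
    unfolding GL11_param_eq_gauss k
    by (simp add: binv flip: b1_def c1_def) (simp add: power2_eq_square algebra_simps ac ev inv)
qed

text \<open>
  The multiplication shifts \<open>\<alpha>\<close> and leaves \<open>k\<close> alone. The factor that the rescaling puts on \<open>a\<close>
  is exactly what keeps \<open>k = a (1 + b\<^sup>2 \<alpha> \<beta> / 2)\<close> constant when \<open>\<alpha>\<close> changes.
\<close>
lemma rescale3_left:
  assumes \<gamma>: "\<gamma> \<in> grass_odd N"
  shows "left_multiplication N (rescale3 \<gamma>) (upper_mat \<gamma>)"
  unfolding left_multiplication_def GL11_inverses(3)[OF \<gamma>]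
proof (intro ballI conjI)
  fix x assume x: "x \<in> GL11_coords N"
  obtain a b \<alpha> \<beta> where x': "x = (a, b, \<alpha>, \<beta>)" by (cases x)
  obtain k where k: "gauss_coords x = (k, b, \<alpha>, \<beta>)" by (simp add: x')
  have ev: "k \<in> grass_even N" "b \<in> grass_even N" "a \<in> grass_even N"
    using gauss_coords_closed[OF x] x unfolding k by (auto simp: x' pos_even)
  have odd: "\<alpha> \<in> grass_odd N" "\<beta> \<in> grass_odd N" using x by (auto simp: x')
  note ac = mult.assoc grass_even_commute[where N = N] grass_even_left_commute[where N = N]
  \<comment> \<open>These rules sort the odd factors, too, so that repeated ones meet and cancel.\<close>
  have anti: "\<gamma> * \<beta> = - (\<beta> * \<gamma>)" "\<gamma> * (\<beta> * z) = - (\<beta> * (\<gamma> * z))" "\<alpha> * \<beta> = - (\<beta> * \<alpha>)"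
    "\<alpha> * (\<beta> * z) = - (\<beta> * (\<alpha> * z))" "\<beta> * \<beta> = 0" "\<beta> * (\<beta> * z) = 0" for z
    using odd \<gamma> by (simp_all add: grass_odd_square grass_odd_left_square
        grass_odd_anticommute[of \<gamma> N \<beta>] grass_odd_left_anticommute[of \<gamma> N \<beta>]
        grass_odd_anticommute[of \<alpha> N \<beta>] grass_odd_left_anticommute[of \<alpha> N \<beta>])
  show "rescale3 \<gamma> x \<in> GL11_coords N"
    using x \<gamma> by (simp add: x' pos_times_one_plus_odd_odd grass_even_power pos_even grass_odd_diff)
  have "(1 - (1/2) *\<^sub>R (b^2 * \<beta> * \<gamma>)) * (1 + (1/2) *\<^sub>R (b^2 * (\<alpha> - \<gamma>) * \<beta>)) = 1 + (1/2) *\<^sub>R (b^2 * \<alpha> * \<beta>)"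
    by (simp add: power2_eq_square algebra_simps ac ev anti)
  then have "gauss_coords (rescale3 \<gamma> x) = (k, b, \<alpha> - \<gamma>, \<beta>)"
    using k by (simp add: x' mult.assoc)
  then show "GL11_param (rescale3 \<gamma> x) = upper_mat (- \<gamma>) \<otimes>\<^bsub>GL11 N\<^esub> GL11_param x"
    unfolding GL11_param_eq_gauss k by (simp add: algebra_simps ac ev)
qed

text \<open>
  As for the third rescaling, but for the shift of \<open>\<beta>\<close> that right multiplication by a lower
  unitriangular matrix causes. The change of orientation from inward to outward accounts for the
  change from left to right multiplication.
\<close>
lemma rescale4_right:
  assumes \<gamma>: "\<gamma> \<in> grass_odd N"
  shows "right_multiplication N (rescale4 \<gamma>) (lower_mat \<gamma>)"
  unfolding right_multiplication_def
proof (intro ballI conjI)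
  fix x assume x: "x \<in> GL11_coords N"
  obtain a b \<alpha> \<beta> where x': "x = (a, b, \<alpha>, \<beta>)" by (cases x)
  obtain k where k: "gauss_coords x = (k, b, \<alpha>, \<beta>)" by (simp add: x')
  have ev: "k \<in> grass_even N" "b \<in> grass_even N" "a \<in> grass_even N"
    using gauss_coords_closed[OF x] x unfolding k by (auto simp: x' pos_even)
  have odd: "\<alpha> \<in> grass_odd N" "\<beta> \<in> grass_odd N" using x by (auto simp: x')
  note ac = mult.assoc grass_even_commute[where N = N] grass_even_left_commute[where N = N]
  have anti: "\<gamma> * \<alpha> = - (\<alpha> * \<gamma>)" "\<gamma> * (\<alpha> * z) = - (\<alpha> * (\<gamma> * z))"
    "\<alpha> * \<alpha> = 0" "\<alpha> * (\<alpha> * z) = 0" for z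
    using odd \<gamma> by (simp_all add: grass_odd_square grass_odd_left_square
        grass_odd_anticommute[of \<gamma> N \<alpha>] grass_odd_left_anticommute[of \<gamma> N \<alpha>])
  show "rescale4 \<gamma> x \<in> GL11_coords N"
    using x \<gamma> by (simp add: x' pos_times_one_plus_odd_odd grass_even_power pos_even grass_odd_add)
  have "(1 - (1/2) *\<^sub>R (b^2 * \<alpha> * \<gamma>)) * (1 + (1/2) *\<^sub>R (b^2 * \<alpha> * (\<beta> + \<gamma>))) = 1 + (1/2) *\<^sub>R (b^2 * \<alpha> * \<beta>)"
    by (simp add: power2_eq_square algebra_simps ac ev anti)
  then have "gauss_coords (rescale4 \<gamma> x) = (k, b, \<alpha>, \<beta> + \<gamma>)"
    using k by (simp add: x' mult.assoc)
  then show "GL11_param (rescale4 \<gamma> x) = GL11_param x \<otimes>\<^bsub>GL11 N\<^esub> lower_mat \<gamma>"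
    unfolding GL11_param_eq_gauss k by (simp add: algebra_simps ac ev)
qed

lemma inward_rescaling_left:
  assumes "f \<in> inward_rescalings N"
  obtains h where "h \<in> carrier (GL11 N)" "left_multiplication N f h"
proof -
  have "scalar_mat c \<in> carrier (GL11 N)" "diag_mat c \<in> carrier (GL11 N)" if "c \<in> grass_pos N" for c
    using that by (auto simp: pos_inverse grass_odd_zero)
  moreover have "upper_mat \<gamma> \<in> carrier (GL11 N)" if "\<gamma> \<in> grass_odd N" for \<gamma>
    using that by (auto simp: pos_one grass_odd_zero)
  ultimately show ?thesis
    using assms that rescale1_left rescale2_left rescale3_left unfolding inward_rescalings_def by blast
qed

lemma outward_rescaling_right:
  assumes "f \<in> outward_rescalings N"
  obtains h where "h \<in> carrier (GL11 N)" "right_multiplication N f h"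
proof -
  obtain \<gamma> where "\<gamma> \<in> grass_odd N" "f = rescale4 \<gamma>"
    using assms by (auto simp: outward_rescalings_def)
  then show ?thesis
    by (intro that[of "lower_mat \<gamma>"]) (simp_all add: rescale4_right pos_one grass_odd_zero)
qed

text \<open>
  The group elements that a single vertex rescaling can realize as the value of a gauge
  transformation.
\<close>
definition rescaling_gauge :: "nat \<Rightarrow> smat \<Rightarrow> bool" where
  "rescaling_gauge N h \<longleftrightarrow> h \<in> carrier (GL11 N) \<and>
    ((\<exists>f\<in>inward_rescalings N. left_multiplication N f h) \<or>
     (\<exists>f\<in>outward_rescalings N. right_multiplication N f h))"

text \<open>
  This is the Gauss decomposition: its four factors correspond to the four kinds of
  vertex rescalings.
\<close>
lemma GL11_generated_by_rescaling_gauges: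
  assumes "m \<in> carrier (GL11 N)"
  obtains h1 h2 h3 h4 where "rescaling_gauge N h1" "rescaling_gauge N h2" "rescaling_gauge N h3"
    "rescaling_gauge N h4"
    "m = h1 \<otimes>\<^bsub>GL11 N\<^esub> (h2 \<otimes>\<^bsub>GL11 N\<^esub> (h3 \<otimes>\<^bsub>GL11 N\<^esub> h4))"
proof -
  obtain k b \<alpha> \<beta> where x: "(k, b, \<alpha>, \<beta>) \<in> GL11_coords N" "gauss_mat (k, b, \<alpha>, \<beta>) = m"
    using gauss_mat_surj[OF assms] by (metis prod_cases4)
  have "rescaling_gauge N (scalar_mat k)" "rescaling_gauge N (diag_mat b)"
    "rescaling_gauge N (upper_mat \<alpha>)" "rescaling_gauge N (lower_mat \<beta>)"
    using x(1) rescale1_left[of k N] rescale2_left[of b N] rescale3_left[of \<alpha> N] rescale4_right[of \<beta> N]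
    by (auto simp: rescaling_gauge_def inward_rescalings_def outward_rescalings_def pos_inverse
        pos_one grass_odd_zero)
  moreover have "\<alpha> * (b * \<beta>) = b * (\<alpha> * \<beta>)"
    using x(1) grass_even_left_commute[of b N \<alpha> \<beta>] by (simp add: pos_even)
  then have "m = scalar_mat k \<otimes>\<^bsub>GL11 N\<^esub> (upper_mat \<alpha> \<otimes>\<^bsub>GL11 N\<^esub> (diag_mat b \<otimes>\<^bsub>GL11 N\<^esub> lower_mat \<beta>))"
    using x(2) by (auto simp: mult.assoc)
  ultimately show ?thesis using that by blast
qed

section \<open>Gauge transformations\<close>

lemma fatgraph_opp:
  assumes "fatgraph \<tau>" "e \<in> oedges \<tau>"
  shows "opp \<tau> e \<in> oedges \<tau>" "opp \<tau> (opp \<tau> e) = e"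
  using assms by (auto simp: fatgraph_def permutes_in_image)

lemma source_opp: "fatgraph \<tau> \<Longrightarrow> e \<in> oedges \<tau> \<Longrightarrow> source \<tau> (opp \<tau> e) = target \<tau> e"
  by (simp add: source_def fatgraph_opp)

lemma target_opp: "target \<tau> (opp \<tau> e) = source \<tau> e"
  by (simp add: source_def)

lemma ends_in_vertices:
  assumes "fatgraph \<tau>" "e \<in> oedges \<tau>"
  shows "target \<tau> e \<in> vertices \<tau>" "source \<tau> e \<in> vertices \<tau>"
  using assms by (auto simp: vertices_def source_def fatgraph_opp)

lemma orientations_subset: "ori \<in> orientations \<tau> \<Longrightarrow> ori \<subseteq> oedges \<tau>"
  and orientations_opp: "ori \<in> orientations \<tau> \<Longrightarrow> e \<in> oedges \<tau> \<Longrightarrow> opp \<tau> e \<in> ori \<longleftrightarrow> e \<notin> ori"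
  by (auto simp: orientations_def)

text \<open>
  Used to turn edges at a vertex towards it, or away from it, while the other edges keep the
  given orientation.
\<close>
lemma orientation_preferring:
  assumes "fatgraph \<tau>" "ori \<in> orientations \<tau>" "\<And>e. e \<in> oedges \<tau> \<Longrightarrow> \<not> (P e \<and> P (opp \<tau> e))"
  shows "{e \<in> oedges \<tau>. P e \<or> \<not> P (opp \<tau> e) \<and> e \<in> ori} \<in> orientations \<tau>"
  using assms(3) orientations_opp[OF assms(2)] fatgraph_opp[OF assms(1)]
  unfolding orientations_def by auto

lemma graph_connection_eqI:
  assumes "fatgraph \<tau>" "ori \<in> orientations \<tau>" "A \<in> graph_connections G \<tau>" "B \<in> graph_connections G \<tau>"
    and eq: "\<And>e. e \<in> ori \<Longrightarrow> A e = B e"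
  shows "A = B"
proof (rule PiE_ext)
  show "A \<in> oedges \<tau> \<rightarrow>\<^sub>E carrier G" "B \<in> oedges \<tau> \<rightarrow>\<^sub>E carrier G"
    using assms by (auto simp: graph_connections_def)
  fix e assume e: "e \<in> oedges \<tau>"
  have "A (opp \<tau> (opp \<tau> e)) = B (opp \<tau> (opp \<tau> e))" if "e \<notin> ori"
    using assms that e orientations_opp[OF assms(2) e] fatgraph_opp(1)[OF assms(1) e]
    by (simp add: graph_connections_def)
  then show "A e = B e" using eq fatgraph_opp(2)[OF assms(1) e] by auto
qed

definition gauge_act ::
  "('g, 'm) monoid_scheme \<Rightarrow> 'e fatgraph \<Rightarrow> ('e set \<Rightarrow> 'g) \<Rightarrow> ('e \<Rightarrow> 'g) \<Rightarrow> 'e \<Rightarrow> 'g" where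
  "gauge_act G \<tau> h A =
    (\<lambda>e\<in>oedges \<tau>. inv\<^bsub>G\<^esub> (h (target \<tau> e)) \<otimes>\<^bsub>G\<^esub> A e \<otimes>\<^bsub>G\<^esub> h (source \<tau> e))"

text \<open>
  These gauge transformations, supported at one vertex, generate the gauge group of a finite graph.
\<close>
definition single_gauge :: "('g, 'm) monoid_scheme \<Rightarrow> 'e set \<Rightarrow> 'g \<Rightarrow> 'e set \<Rightarrow> 'g" where
  "single_gauge G u k = (\<lambda>v. if v = u then k else \<one>\<^bsub>G\<^esub>)"

context group
begin

lemma connection_closed: "A \<in> graph_connections G \<tau> \<Longrightarrow> e \<in> oedges \<tau> \<Longrightarrow> A e \<in> carrier G"
  by (auto simp: graph_connections_def)

lemma gauge_act_closed:
  assumes "fatgraph \<tau>" "A \<in> graph_connections G \<tau>" "h \<in> vertices \<tau> \<rightarrow> carrier G"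
  shows "gauge_act G \<tau> h A \<in> graph_connections G \<tau>"
proof -
  have h: "h (target \<tau> e) \<in> carrier G" "h (source \<tau> e) \<in> carrier G" if "e \<in> oedges \<tau>" for e
    using ends_in_vertices[OF assms(1) that] assms(3) by (auto simp: Pi_iff)
  have A: "A e \<in> carrier G" if "e \<in> oedges \<tau>" for e by (rule connection_closed[OF assms(2) that])
  have A_opp: "A (opp \<tau> e) = inv (A e)" if "e \<in> oedges \<tau>" for e
    using assms(2) that by (simp add: graph_connections_def)
  show ?thesis
    unfolding graph_connections_def gauge_act_def mem_Collect_eq
  proof (intro conjI ballI)
    show "(\<lambda>e\<in>oedges \<tau>. inv (h (target \<tau> e)) \<otimes> A e \<otimes> h (source \<tau> e)) \<in> oedges \<tau> \<rightarrow>\<^sub>E carrier G"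
      using h A by (intro restrict_PiE[THEN iffD2] funcsetI) simp
    fix e assume e: "e \<in> oedges \<tau>"
    show "(\<lambda>e\<in>oedges \<tau>. inv (h (target \<tau> e)) \<otimes> A e \<otimes> h (source \<tau> e)) (opp \<tau> e) =
        inv ((\<lambda>e\<in>oedges \<tau>. inv (h (target \<tau> e)) \<otimes> A e \<otimes> h (source \<tau> e)) e)"
      using e h[OF e] A[OF e]
      by (simp add: fatgraph_opp(1)[OF assms(1)] target_opp source_opp[OF assms(1)] A_opp
          inv_mult_group m_assoc)
  qed
qed

lemma gauge_act_one:
  assumes A: "A \<in> graph_connections G \<tau>"
  shows "gauge_act G \<tau> (\<lambda>_. \<one>) A = A"
proof
  fix e show "gauge_act G \<tau> (\<lambda>_. \<one>) A e = A e"
    using A connection_closed[OF A] PiE_arb[of A "oedges \<tau>" "\<lambda>_. carrier G" e]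
    by (auto simp: gauge_act_def graph_connections_def)
qed

text \<open>
  The gauge group acts on the right: \<open>h\<close> is applied first.
\<close>
lemma gauge_act_mult:
  assumes "fatgraph \<tau>" "A \<in> graph_connections G \<tau>" "h \<in> vertices \<tau> \<rightarrow> carrier G"
    "k \<in> vertices \<tau> \<rightarrow> carrier G"
  shows "gauge_act G \<tau> k (gauge_act G \<tau> h A) = gauge_act G \<tau> (\<lambda>v. h v \<otimes> k v) A"
proof
  fix e
  have "h v \<in> carrier G" "k v \<in> carrier G" if "v \<in> vertices \<tau>" for v using assms(3,4) that by (auto simp: Pi_iff)
  then show "gauge_act G \<tau> k (gauge_act G \<tau> h A) e = gauge_act G \<tau> (\<lambda>v. h v \<otimes> k v) A e"
    using assms(1) connection_closed[OF assms(2)]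
    by (simp add: gauge_act_def ends_in_vertices inv_mult_group m_assoc)
qed

lemma gauge_act_cong:
  assumes "fatgraph \<tau>" "\<And>v. v \<in> vertices \<tau> \<Longrightarrow> h v = k v"
  shows "gauge_act G \<tau> h A = gauge_act G \<tau> k A"
  using assms by (auto simp: gauge_act_def ends_in_vertices)

lemma gauge_equiv_iff:
  assumes "fatgraph \<tau>" "A \<in> graph_connections G \<tau>"
  shows "(A, B) \<in> gauge_equiv G \<tau> \<longleftrightarrow> (\<exists>h \<in> vertices \<tau> \<rightarrow> carrier G. B = gauge_act G \<tau> h A)"
proof
  assume "(A, B) \<in> gauge_equiv G \<tau>"
  then obtain h where B: "B \<in> graph_connections G \<tau>" and h: "h \<in> vertices \<tau> \<rightarrow> carrier G"
    "\<forall>e\<in>oedges \<tau>. B e = inv (h (target \<tau> e)) \<otimes> A e \<otimes> h (source \<tau> e)"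
    unfolding gauge_equiv_def by blast
  have "B = gauge_act G \<tau> h A"
  proof
    fix e show "B e = gauge_act G \<tau> h A e"
      using h(2) PiE_arb[of B "oedges \<tau>" "\<lambda>_. carrier G" e] B
      by (auto simp: gauge_act_def graph_connections_def)
  qed
  then show "\<exists>h \<in> vertices \<tau> \<rightarrow> carrier G. B = gauge_act G \<tau> h A" using h(1) by blast
next
  assume "\<exists>h \<in> vertices \<tau> \<rightarrow> carrier G. B = gauge_act G \<tau> h A"
  then obtain h where h: "h \<in> vertices \<tau> \<rightarrow> carrier G" "B = gauge_act G \<tau> h A" by blast
  then have "\<forall>e\<in>oedges \<tau>. B e = inv (h (target \<tau> e)) \<otimes> A e \<otimes> h (source \<tau> e)"
    by (simp add: gauge_act_def)
  then show "(A, B) \<in> gauge_equiv G \<tau>"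
    using gauge_act_closed[OF assms h(1)] assms(2) h unfolding gauge_equiv_def by blast
qed

lemma gauge_equiv_equiv:
  assumes "fatgraph \<tau>"
  shows "equiv (graph_connections G \<tau>) (gauge_equiv G \<tau>)"
proof (rule equivI)
  show sub: "gauge_equiv G \<tau> \<subseteq> graph_connections G \<tau> \<times> graph_connections G \<tau>"
    by (auto simp: gauge_equiv_def)
  show "refl_on (graph_connections G \<tau>) (gauge_equiv G \<tau>)"
  proof (rule refl_onI)
    fix A assume A: "A \<in> graph_connections G \<tau>"
    then show "(A, A) \<in> gauge_equiv G \<tau>"
      unfolding gauge_equiv_iff[OF assms A] by (intro bexI[of _ "\<lambda>_. \<one>"]) (auto simp: gauge_act_one)
  qed
  show "sym (gauge_equiv G \<tau>)"
  proof (rule symI)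
    fix A B assume AB: "(A, B) \<in> gauge_equiv G \<tau>"
    then have A: "A \<in> graph_connections G \<tau>" and B: "B \<in> graph_connections G \<tau>" using sub by auto
    obtain h where h: "h \<in> vertices \<tau> \<rightarrow> carrier G" "B = gauge_act G \<tau> h A"
      using AB gauge_equiv_iff[OF assms A] by blast
    have inv: "(\<lambda>v. inv (h v)) \<in> vertices \<tau> \<rightarrow> carrier G" using h(1) by (auto simp: Pi_iff)
    have "gauge_act G \<tau> (\<lambda>v. inv (h v)) B = gauge_act G \<tau> (\<lambda>v. h v \<otimes> inv (h v)) A"
      unfolding h(2) by (rule gauge_act_mult[OF assms A h(1) inv])
    also have "\<dots> = gauge_act G \<tau> (\<lambda>_. \<one>) A"
      using h(1) by (intro gauge_act_cong[OF assms]) (auto simp: Pi_iff)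
    finally show "(B, A) \<in> gauge_equiv G \<tau>"
      unfolding gauge_equiv_iff[OF assms B] using inv gauge_act_one[OF A] by metis
  qed
  show "trans (gauge_equiv G \<tau>)"
  proof (rule transI)
    fix A B C assume AB: "(A, B) \<in> gauge_equiv G \<tau>" and BC: "(B, C) \<in> gauge_equiv G \<tau>"
    then have A: "A \<in> graph_connections G \<tau>" and B: "B \<in> graph_connections G \<tau>" using sub by auto
    obtain h k where hk: "h \<in> vertices \<tau> \<rightarrow> carrier G" "B = gauge_act G \<tau> h A"
      "k \<in> vertices \<tau> \<rightarrow> carrier G" "C = gauge_act G \<tau> k B"
      using AB BC gauge_equiv_iff[OF assms A] gauge_equiv_iff[OF assms B] by blast
    then have "C = gauge_act G \<tau> (\<lambda>v. h v \<otimes> k v) A" using gauge_act_mult[OF assms A] by simp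
    moreover have "(\<lambda>v. h v \<otimes> k v) \<in> vertices \<tau> \<rightarrow> carrier G" using hk by (auto simp: Pi_iff)
    ultimately show "(A, C) \<in> gauge_equiv G \<tau>" unfolding gauge_equiv_iff[OF assms A] by blast
  qed
qed

lemma single_gauge_closed: "k \<in> carrier G \<Longrightarrow> single_gauge G u k \<in> V \<rightarrow> carrier G"
  by (auto simp: single_gauge_def)

end

section \<open>Charts\<close>

lemma chart_mem: "x \<in> chart N ori \<Longrightarrow> e \<in> ori \<Longrightarrow> x e \<in> GL11_coords N"
  by (auto simp: chart_def)

lemma chart_connection_on_ori:
  "ori \<in> orientations \<tau> \<Longrightarrow> e \<in> ori \<Longrightarrow> chart_connection N \<tau> ori x e = GL11_param (x e)"
  using orientations_subset by (fastforce simp: chart_connection_def)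

lemma chart_connection_closed:
  assumes "fatgraph \<tau>" "ori \<in> orientations \<tau>" "x \<in> chart N ori"
  shows "chart_connection N \<tau> ori x \<in> graph_connections (GL11 N) \<tau>"
proof -
  interpret G: group "GL11 N" by (rule GL11_group)
  have x: "GL11_param (x e) \<in> carrier (GL11 N)" if "e \<in> ori" for e
    using chart_mem[OF assms(3) that] by (rule GL11_param_closed)
  show ?thesis
    unfolding graph_connections_def chart_connection_def
    using assms(1) x orientations_opp[OF assms(2)]
    by (auto simp: fatgraph_opp simp del: GL11_simps)
qed

lemma chart_connection_bij:
  assumes "fatgraph \<tau>" "ori \<in> orientations \<tau>"
  shows "bij_betw (chart_connection N \<tau> ori) (chart N ori) (graph_connections (GL11 N) \<tau>)"
proof (rule bij_betw_imageI)
  note P = GL11_param_bij[of N]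
  show "inj_on (chart_connection N \<tau> ori) (chart N ori)"
  proof (rule inj_onI)
    fix x y assume x: "x \<in> chart N ori" and y: "y \<in> chart N ori"
      and eq: "chart_connection N \<tau> ori x = chart_connection N \<tau> ori y"
    show "x = y"
    proof (rule PiE_ext)
      show "x \<in> ori \<rightarrow>\<^sub>E GL11_coords N" "y \<in> ori \<rightarrow>\<^sub>E GL11_coords N" using x y by (auto simp: chart_def)
      fix e assume e: "e \<in> ori"
      then have "GL11_param (x e) = GL11_param (y e)"
        using eq chart_connection_on_ori[OF assms(2)] by metis
      then show "x e = y e"
        using bij_betw_imp_inj_on[OF P] chart_mem x y e by (metis inj_onD)
    qed
  qed
  show "chart_connection N \<tau> ori ` chart N ori = graph_connections (GL11 N) \<tau>"
  proof
    show "chart_connection N \<tau> ori ` chart N ori \<subseteq> graph_connections (GL11 N) \<tau>"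
      using chart_connection_closed[OF assms] by blast
    show "graph_connections (GL11 N) \<tau> \<subseteq> chart_connection N \<tau> ori ` chart N ori"
    proof
      fix A assume A: "A \<in> graph_connections (GL11 N) \<tau>"
      define x where "x = (\<lambda>e\<in>ori. inv_into (GL11_coords N) GL11_param (A e))"
      have A_mem: "A e \<in> GL11_param ` GL11_coords N" if "e \<in> ori" for e
        using A that orientations_subset[OF assms(2)] bij_betw_imp_surj_on[OF P]
        by (auto simp: graph_connections_def)
      have x: "x \<in> chart N ori" unfolding chart_def x_def using inv_into_into[OF A_mem] by auto
      have "chart_connection N \<tau> ori x = A"
        using chart_connection_closed[OF assms x] A
        by (rule graph_connection_eqI[OF assms])
          (simp add: chart_connection_on_ori[OF assms(2)] x_def f_inv_into_f[OF A_mem] del: GL11_param.simps)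
      then show "A \<in> chart_connection N \<tau> ori ` chart N ori" using x by blast
    qed
  qed
qed

subsection \<open>Coordinate changes are gauge transformations\<close>

lemma edge_reversal_connection:
  assumes "fatgraph \<tau>" "ori \<in> orientations \<tau>" "ori' \<in> orientations \<tau>" "x \<in> chart N ori" "x' \<in> chart N ori'"
    and x': "\<And>e. e \<in> ori' \<Longrightarrow> x' e = (if e \<in> ori then x e else reverse_coords (x (opp \<tau> e)))"
  shows "chart_connection N \<tau> ori' x' = chart_connection N \<tau> ori x"
proof (rule graph_connection_eqI[OF assms(1,3) chart_connection_closed[OF assms(1,3,5)]
      chart_connection_closed[OF assms(1,2,4)]])
  fix e assume e: "e \<in> ori'"
  then have oe: "e \<in> oedges \<tau>" using orientations_subset[OF assms(3)] by blast
  have "GL11_param (x' e) = chart_connection N \<tau> ori x e"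
  proof (cases "e \<in> ori")
    case False
    then have "x (opp \<tau> e) \<in> GL11_coords N" using chart_mem[OF assms(4)] orientations_opp[OF assms(2) oe] by blast
    then show ?thesis using False e oe
      by (simp add: x' chart_connection_def GL11_param_reverse del: GL11_param.simps)
  qed (simp add: x' e chart_connection_on_ori[OF assms(2)])
  then show "chart_connection N \<tau> ori' x' e = chart_connection N \<tau> ori x e"
    by (simp add: chart_connection_on_ori[OF assms(3) e])
qed

lemma change_orientation:
  assumes "fatgraph \<tau>" "ori \<in> orientations \<tau>" "ori' \<in> orientations \<tau>" "x \<in> chart N ori"
  obtains x' where "x' \<in> chart N ori'" "chart_step N \<tau> (ori, x) (ori', x')"
    "chart_connection N \<tau> ori' x' = chart_connection N \<tau> ori x"
proof -
  define x' where "x' = (\<lambda>e\<in>ori'. if e \<in> ori then x e else reverse_coords (x (opp \<tau> e)))"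
  have "opp \<tau> e \<in> ori" if "e \<in> ori'" "e \<notin> ori" for e
    using that orientations_subset[OF assms(3)] orientations_opp[OF assms(2)] by blast
  then have x': "x' \<in> chart N ori'"
    using chart_mem[OF assms(4)] by (auto simp: chart_def x'_def intro!: reverse_coords_closed)
  have val: "x' e = (if e \<in> ori then x e else reverse_coords (x (opp \<tau> e)))" if "e \<in> ori'" for e
    using that by (simp add: x'_def)
  show ?thesis
    using that[OF x' chart_step.edge_reversal[OF assms(2,3,4) x' val]
        edge_reversal_connection[OF assms x' val]] .
qed

text \<open>
  On a loop at \<open>u\<close> the coordinate change is applied once in each orientation. Since reversal is
  inversion, this gives \<open>(h\<^sup>-\<^sup>1 (h\<^sup>-\<^sup>1 A)\<^sup>-\<^sup>1)\<^sup>-\<^sup>1 = h\<^sup>-\<^sup>1 A h\<close>, as a gauge transformation requires.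
\<close>
lemma rescale_towards_gauge:
  assumes "fatgraph \<tau>" "ori \<in> orientations \<tau>" "x \<in> chart N ori"
    and h: "h \<in> carrier (GL11 N)" and f: "left_multiplication N f h"
    and towards: "\<And>e. e \<in> ori \<Longrightarrow> source \<tau> e = u \<Longrightarrow> target \<tau> e = u"
  shows "rescale_towards \<tau> ori u f x \<in> chart N ori"
    and "chart_connection N \<tau> ori (rescale_towards \<tau> ori u f x) =
      gauge_act (GL11 N) \<tau> (single_gauge (GL11 N) u h) (chart_connection N \<tau> ori x)"
proof -
  interpret G: group "GL11 N" by (rule GL11_group)
  let ?y = "rescale_towards \<tau> ori u f x"
  have f_closed: "f z \<in> GL11_coords N"
    and f_param: "GL11_param (f z) = inv\<^bsub>GL11 N\<^esub> h \<otimes>\<^bsub>GL11 N\<^esub> GL11_param z"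
    if "z \<in> GL11_coords N" for z using f that by (auto simp: left_multiplication_def)
  show y: "?y \<in> chart N ori"
    using chart_mem[OF assms(3)]
    by (auto simp: chart_def rescale_towards_def intro!: f_closed reverse_coords_closed)
  show "chart_connection N \<tau> ori ?y =
      gauge_act (GL11 N) \<tau> (single_gauge (GL11 N) u h) (chart_connection N \<tau> ori x)"
  proof (rule graph_connection_eqI[OF assms(1,2)])
    show "chart_connection N \<tau> ori ?y \<in> graph_connections (GL11 N) \<tau>"
      by (rule chart_connection_closed[OF assms(1,2) y])
    show "gauge_act (GL11 N) \<tau> (single_gauge (GL11 N) u h) (chart_connection N \<tau> ori x)
        \<in> graph_connections (GL11 N) \<tau>"
      by (intro G.gauge_act_closed chart_connection_closed G.single_gauge_closed assms)
    fix e assume e: "e \<in> ori"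
    have xe: "x e \<in> GL11_coords N" by (rule chart_mem[OF assms(3) e])
    have "GL11_param (?y e) = inv\<^bsub>GL11 N\<^esub> (single_gauge (GL11 N) u h (target \<tau> e)) \<otimes>\<^bsub>GL11 N\<^esub>
        GL11_param (x e) \<otimes>\<^bsub>GL11 N\<^esub> single_gauge (GL11 N) u h (source \<tau> e)"
      using towards[OF e] e xe h
      by (auto simp: rescale_towards_def single_gauge_def f_param f_closed reverse_coords_closed
          GL11_param_reverse[where N = N] GL11_param_closed G.inv_mult_group G.m_assoc
          simp del: GL11_simps GL11_param.simps)
    then show "chart_connection N \<tau> ori ?y e =
        gauge_act (GL11 N) \<tau> (single_gauge (GL11 N) u h) (chart_connection N \<tau> ori x) e"
      using e orientations_subset[OF assms(2)]
      by (auto simp: gauge_act_def chart_connection_on_ori[OF assms(2) e] simp del: GL11_simps GL11_param.simps)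
  qed
qed

text \<open>
  For a loop the corresponding computation is \<open>((A h)\<^sup>-\<^sup>1 h)\<^sup>-\<^sup>1 = h\<^sup>-\<^sup>1 A h\<close>.
\<close>
lemma rescale_away_gauge:
  assumes "fatgraph \<tau>" "ori \<in> orientations \<tau>" "x \<in> chart N ori"
    and h: "h \<in> carrier (GL11 N)" and f: "right_multiplication N f h"
    and away: "\<And>e. e \<in> ori \<Longrightarrow> target \<tau> e = u \<Longrightarrow> source \<tau> e = u"
  shows "rescale_away \<tau> ori u f x \<in> chart N ori"
    and "chart_connection N \<tau> ori (rescale_away \<tau> ori u f x) =
      gauge_act (GL11 N) \<tau> (single_gauge (GL11 N) u h) (chart_connection N \<tau> ori x)"
proof -
  interpret G: group "GL11 N" by (rule GL11_group)
  let ?y = "rescale_away \<tau> ori u f x"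
  have f_closed: "f z \<in> GL11_coords N"
    and f_param: "GL11_param (f z) = GL11_param z \<otimes>\<^bsub>GL11 N\<^esub> h"
    if "z \<in> GL11_coords N" for z using f that by (auto simp: right_multiplication_def)
  show y: "?y \<in> chart N ori"
    using chart_mem[OF assms(3)]
    by (auto simp: chart_def rescale_away_def intro!: f_closed reverse_coords_closed)
  show "chart_connection N \<tau> ori ?y =
      gauge_act (GL11 N) \<tau> (single_gauge (GL11 N) u h) (chart_connection N \<tau> ori x)"
  proof (rule graph_connection_eqI[OF assms(1,2)])
    show "chart_connection N \<tau> ori ?y \<in> graph_connections (GL11 N) \<tau>"
      by (rule chart_connection_closed[OF assms(1,2) y])
    show "gauge_act (GL11 N) \<tau> (single_gauge (GL11 N) u h) (chart_connection N \<tau> ori x)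
        \<in> graph_connections (GL11 N) \<tau>"
      by (intro G.gauge_act_closed chart_connection_closed G.single_gauge_closed assms)
    fix e assume e: "e \<in> ori"
    have xe: "x e \<in> GL11_coords N" by (rule chart_mem[OF assms(3) e])
    have "GL11_param (?y e) = inv\<^bsub>GL11 N\<^esub> (single_gauge (GL11 N) u h (target \<tau> e)) \<otimes>\<^bsub>GL11 N\<^esub>
        GL11_param (x e) \<otimes>\<^bsub>GL11 N\<^esub> single_gauge (GL11 N) u h (source \<tau> e)"
      using away[OF e] e xe h
      by (auto simp: rescale_away_def single_gauge_def f_param f_closed reverse_coords_closed
          GL11_param_reverse[where N = N] GL11_param_closed G.inv_mult_group G.m_assoc
          simp del: GL11_simps GL11_param.simps)
    then show "chart_connection N \<tau> ori ?y e =
        gauge_act (GL11 N) \<tau> (single_gauge (GL11 N) u h) (chart_connection N \<tau> ori x) e"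
      using e orientations_subset[OF assms(2)]
      by (auto simp: gauge_act_def chart_connection_on_ori[OF assms(2) e] simp del: GL11_simps GL11_param.simps)
  qed
qed

lemma chart_step_gauge_equiv:
  assumes "fatgraph \<tau>" "chart_step N \<tau> p q"
  shows "(case_prod (chart_connection N \<tau>) p, case_prod (chart_connection N \<tau>) q) \<in> gauge_equiv (GL11 N) \<tau>"
proof -
  interpret G: group "GL11 N" by (rule GL11_group)
  have single: "(A, gauge_act (GL11 N) \<tau> (single_gauge (GL11 N) u h) A) \<in> gauge_equiv (GL11 N) \<tau>"
    if "A \<in> graph_connections (GL11 N) \<tau>" "h \<in> carrier (GL11 N)" for A u h
    using G.gauge_equiv_iff[OF assms(1) that(1)] G.single_gauge_closed[OF that(2)] by blast
  show ?thesis
    using assms(2)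
  proof cases
    case (edge_reversal ori ori' x x')
    then show ?thesis
      using edge_reversal_connection[OF assms(1) edge_reversal(3-7)]
        equiv_class_self[OF G.gauge_equiv_equiv[OF assms(1)] chart_connection_closed[OF assms(1)]]
      by simp
  next
    case (rescaling_towards ori x u f)
    then obtain h where "h \<in> carrier (GL11 N)" "left_multiplication N f h"
      using inward_rescaling_left by blast
    then show ?thesis
      using rescale_towards_gauge(2)[OF assms(1) rescaling_towards(3,4)] rescaling_towards
        single[OF chart_connection_closed[OF assms(1) rescaling_towards(3,4)]] by simp
  next
    case (rescaling_away ori x u f)
    then obtain h where "h \<in> carrier (GL11 N)" "right_multiplication N f h"
      using outward_rescaling_right by blast
    then show ?thesis
      using rescale_away_gauge(2)[OF assms(1) rescaling_away(3,4)] rescaling_away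
        single[OF chart_connection_closed[OF assms(1) rescaling_away(3,4)]] by simp
  qed
qed

lemma chart_equiv_gauge_equiv:
  assumes "fatgraph \<tau>" "ori \<in> orientations \<tau>" "(x, y) \<in> chart_equiv N \<tau> ori"
  shows "(chart_connection N \<tau> ori x, chart_connection N \<tau> ori y) \<in> gauge_equiv (GL11 N) \<tau>"
proof -
  let ?R = "gauge_equiv (GL11 N) \<tau>" and ?c = "case_prod (chart_connection N \<tau>)"
  have eq: "equiv (graph_connections (GL11 N) \<tau>) ?R"
    by (rule group.gauge_equiv_equiv[OF GL11_group assms(1)])
  have x: "x \<in> chart N ori" and steps: "equivclp (chart_step N \<tau>) (ori, x) (ori, y)"
    using assms(3) by (auto simp: chart_equiv_def)
  from steps have "(?c (ori, x), ?c (ori, y)) \<in> ?R"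
  proof (induction rule: equivclp_induct)
    case base
    show ?case using chart_connection_closed[OF assms(1,2) x] equiv_class_self[OF eq] by simp
  next
    case (step q r)
    then have "(?c q, ?c r) \<in> ?R"
      using chart_step_gauge_equiv[OF assms(1)] eq by (meson equivE symD)
    then show ?case using step.IH eq by (meson equivE transD)
  qed
  then show ?thesis by simp
qed

subsection \<open>Gauge transformations are coordinate changes\<close>

text \<open>
  Whatever connection such a gauge transformation is applied to, its effect is a sequence of
  coordinate changes. The definition speaks of all points of the chart at once, so that realizable
  gauge transformations can be composed.
\<close>
definition realizable_gauge :: "nat \<Rightarrow> 'e fatgraph \<Rightarrow> 'e set \<Rightarrow> ('e set \<Rightarrow> smat) \<Rightarrow> bool" where
  "realizable_gauge N \<tau> ori h \<longleftrightarrow> h \<in> vertices \<tau> \<rightarrow> carrier (GL11 N) \<and>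
    (\<forall>x\<in>chart N ori. \<exists>y. (x, y) \<in> chart_equiv N \<tau> ori \<and>
      chart_connection N \<tau> ori y = gauge_act (GL11 N) \<tau> h (chart_connection N \<tau> ori x))"

lemma chart_equiv_equiv: "equiv (chart N ori) (chart_equiv N \<tau> ori)"
  by (rule equivI)
    (auto simp: chart_equiv_def intro!: refl_onI symI transI intro: equivclp_sym equivclp_trans)

lemma realizable_gauge_mult:
  assumes "fatgraph \<tau>" "ori \<in> orientations \<tau>" "realizable_gauge N \<tau> ori h" "realizable_gauge N \<tau> ori k"
  shows "realizable_gauge N \<tau> ori (\<lambda>v. h v \<otimes>\<^bsub>GL11 N\<^esub> k v)"
  unfolding realizable_gauge_def
proof (intro conjI ballI)
  interpret G: group "GL11 N" by (rule GL11_group)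
  have hk: "h \<in> vertices \<tau> \<rightarrow> carrier (GL11 N)" "k \<in> vertices \<tau> \<rightarrow> carrier (GL11 N)"
    using assms(3,4) by (auto simp: realizable_gauge_def)
  then show "(\<lambda>v. h v \<otimes>\<^bsub>GL11 N\<^esub> k v) \<in> vertices \<tau> \<rightarrow> carrier (GL11 N)"
    by (auto simp: Pi_iff simp del: GL11_simps)
  fix x assume x: "x \<in> chart N ori"
  obtain y where y: "(x, y) \<in> chart_equiv N \<tau> ori"
    "chart_connection N \<tau> ori y = gauge_act (GL11 N) \<tau> h (chart_connection N \<tau> ori x)"
    using assms(3) x by (auto simp: realizable_gauge_def)
  then have "y \<in> chart N ori" by (auto simp: chart_equiv_def)
  then obtain z where z: "(y, z) \<in> chart_equiv N \<tau> ori"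
    "chart_connection N \<tau> ori z = gauge_act (GL11 N) \<tau> k (chart_connection N \<tau> ori y)"
    using assms(4) by (auto simp: realizable_gauge_def)
  have "(x, z) \<in> chart_equiv N \<tau> ori"
    using chart_equiv_equiv y(1) z(1) by (meson equivE transD)
  moreover have "chart_connection N \<tau> ori z =
      gauge_act (GL11 N) \<tau> (\<lambda>v. h v \<otimes>\<^bsub>GL11 N\<^esub> k v) (chart_connection N \<tau> ori x)"
    unfolding z(2) y(2)
    by (rule G.gauge_act_mult[OF assms(1) chart_connection_closed[OF assms(1,2) x] hk])
  ultimately show "\<exists>y. (x, y) \<in> chart_equiv N \<tau> ori \<and> chart_connection N \<tau> ori y =
      gauge_act (GL11 N) \<tau> (\<lambda>v. h v \<otimes>\<^bsub>GL11 N\<^esub> k v) (chart_connection N \<tau> ori x)" by blast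
qed

text \<open>
  A rescaling is only allowed in an orientation in which the edges at \<open>u\<close> point the right way. So
  one reverses edges to get there, rescales, and reverses them back; the reversals do not
  change the connection.
\<close>
lemma realizable_rescaling_gauge:
  assumes "fatgraph \<tau>" "ori \<in> orientations \<tau>" "u \<in> vertices \<tau>" "rescaling_gauge N h"
  shows "realizable_gauge N \<tau> ori (single_gauge (GL11 N) u h)"
  unfolding realizable_gauge_def
proof (intro conjI ballI)
  have h: "h \<in> carrier (GL11 N)" using assms(4) by (simp add: rescaling_gauge_def)
  show "single_gauge (GL11 N) u h \<in> vertices \<tau> \<rightarrow> carrier (GL11 N)"
    by (rule group.single_gauge_closed[OF GL11_group h])
  fix x assume x: "x \<in> chart N ori"
  let ?act = "gauge_act (GL11 N) \<tau> (single_gauge (GL11 N) u h)"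
  have "\<exists>ori'\<in>orientations \<tau>. \<forall>x'\<in>chart N ori'. \<exists>y'\<in>chart N ori'. chart_step N \<tau> (ori', x') (ori', y') \<and>
      chart_connection N \<tau> ori' y' = ?act (chart_connection N \<tau> ori' x')"
    using assms(4) unfolding rescaling_gauge_def
  proof (elim conjE disjE bexE)
    fix f assume f: "f \<in> inward_rescalings N" "left_multiplication N f h"
    \<comment> \<open>The edges that join \<open>u\<close> to another vertex are turned towards \<open>u\<close>.\<close>
    let ?P = "\<lambda>e. target \<tau> e = u \<and> source \<tau> e \<noteq> u"
    let ?ori = "{e \<in> oedges \<tau>. ?P e \<or> \<not> ?P (opp \<tau> e) \<and> e \<in> ori}"
    have ori': "?ori \<in> orientations \<tau>"
      by (rule orientation_preferring[OF assms(1,2)]) (auto simp: target_opp)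
    have towards: "target \<tau> e = u" if "e \<in> ?ori" "source \<tau> e = u" for e
      using that source_opp[OF assms(1), of e] by (auto simp: target_opp)
    show ?thesis
      using chart_step.rescaling_towards[OF ori' _ assms(3) f(1) towards]
        rescale_towards_gauge[OF assms(1) ori' _ h f(2) towards] ori' by blast
  next
    fix f assume f: "f \<in> outward_rescalings N" "right_multiplication N f h"
    \<comment> \<open>The edges that join \<open>u\<close> to another vertex are turned away from \<open>u\<close>.\<close>
    let ?P = "\<lambda>e. source \<tau> e = u \<and> target \<tau> e \<noteq> u"
    let ?ori = "{e \<in> oedges \<tau>. ?P e \<or> \<not> ?P (opp \<tau> e) \<and> e \<in> ori}"
    have ori': "?ori \<in> orientations \<tau>"
      by (rule orientation_preferring[OF assms(1,2)]) (auto simp: target_opp)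
    have away: "source \<tau> e = u" if "e \<in> ?ori" "target \<tau> e = u" for e
      using that source_opp[OF assms(1), of e] by (auto simp: target_opp)
    show ?thesis
      using chart_step.rescaling_away[OF ori' _ assms(3) f(1) away]
        rescale_away_gauge[OF assms(1) ori' _ h f(2) away] ori' by blast
  qed
  then obtain ori' where ori': "ori' \<in> orientations \<tau>" and step: "\<And>x'. x' \<in> chart N ori' \<Longrightarrow>
      \<exists>y'\<in>chart N ori'. chart_step N \<tau> (ori', x') (ori', y') \<and>
        chart_connection N \<tau> ori' y' = ?act (chart_connection N \<tau> ori' x')" by blast
  obtain x' where x': "x' \<in> chart N ori'" "chart_step N \<tau> (ori, x) (ori', x')"
    "chart_connection N \<tau> ori' x' = chart_connection N \<tau> ori x"
    using change_orientation[OF assms(1,2) ori' x] .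
  obtain y' where y': "y' \<in> chart N ori'" "chart_step N \<tau> (ori', x') (ori', y')"
    "chart_connection N \<tau> ori' y' = ?act (chart_connection N \<tau> ori' x')" using step[OF x'(1)] by blast
  obtain y where y: "y \<in> chart N ori" "chart_step N \<tau> (ori', y') (ori, y)"
    "chart_connection N \<tau> ori y = chart_connection N \<tau> ori' y'"
    using change_orientation[OF assms(1) ori' assms(2) y'(1)] .
  have "equivclp (chart_step N \<tau>) (ori, x) (ori, y)"
    using r_into_equivclp[where r = "chart_step N \<tau>"] x'(2) y'(2) y(2) by (meson equivclp_trans)
  then show "\<exists>y. (x, y) \<in> chart_equiv N \<tau> ori \<and>
      chart_connection N \<tau> ori y = ?act (chart_connection N \<tau> ori x)"
    using x y(1) y(3) y'(3) x'(3) by (intro exI[of _ y]) (simp add: chart_equiv_def)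
qed

lemma realizable_single_gauge:
  assumes "fatgraph \<tau>" "ori \<in> orientations \<tau>" "u \<in> vertices \<tau>" "m \<in> carrier (GL11 N)"
  shows "realizable_gauge N \<tau> ori (single_gauge (GL11 N) u m)"
proof -
  interpret G: group "GL11 N" by (rule GL11_group)
  have mult: "realizable_gauge N \<tau> ori (single_gauge (GL11 N) u (h \<otimes>\<^bsub>GL11 N\<^esub> k))"
    if "realizable_gauge N \<tau> ori (single_gauge (GL11 N) u h)"
      "realizable_gauge N \<tau> ori (single_gauge (GL11 N) u k)" for h k
  proof -
    have "single_gauge (GL11 N) u (h \<otimes>\<^bsub>GL11 N\<^esub> k) =
        (\<lambda>v. single_gauge (GL11 N) u h v \<otimes>\<^bsub>GL11 N\<^esub> single_gauge (GL11 N) u k v)"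
      by (auto simp: single_gauge_def simp del: GL11_simps)
    then show ?thesis using realizable_gauge_mult[OF assms(1,2) that] by simp
  qed
  obtain h1 h2 h3 h4 where "rescaling_gauge N h1" "rescaling_gauge N h2" "rescaling_gauge N h3"
    "rescaling_gauge N h4" "m = h1 \<otimes>\<^bsub>GL11 N\<^esub> (h2 \<otimes>\<^bsub>GL11 N\<^esub> (h3 \<otimes>\<^bsub>GL11 N\<^esub> h4))"
    using GL11_generated_by_rescaling_gauges[OF assms(4)] .
  then show ?thesis using mult realizable_rescaling_gauge[OF assms(1-3)] by simp
qed

text \<open>
  A gauge transformation of a finite graph is the product of its values at the single vertices,
  taken one vertex at a time.
\<close>
lemma realizable_gauge_all:
  assumes "fatgraph \<tau>" "ori \<in> orientations \<tau>" "h \<in> vertices \<tau> \<rightarrow> carrier (GL11 N)"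
  shows "realizable_gauge N \<tau> ori h"
proof -
  interpret G: group "GL11 N" by (rule GL11_group)
  let ?r = "\<lambda>V v. if v \<in> V then h v else \<one>\<^bsub>GL11 N\<^esub>"
  have fin: "finite (vertices \<tau>)" using assms(1) by (simp add: vertices_def fatgraph_def)
  have "realizable_gauge N \<tau> ori (?r V)" if "V \<subseteq> vertices \<tau>" for V
    using finite_subset[OF that fin] that
  proof (induction V rule: finite_induct)
    case empty
    show ?case
      unfolding realizable_gauge_def
    proof (intro conjI ballI exI)
      fix x assume x: "x \<in> chart N ori"
      show "(x, x) \<in> chart_equiv N \<tau> ori" using x by (simp add: chart_equiv_def)
      show "chart_connection N \<tau> ori x = gauge_act (GL11 N) \<tau> (?r {}) (chart_connection N \<tau> ori x)"
        using G.gauge_act_one[OF chart_connection_closed[OF assms(1,2) x]] by (simp del: GL11_simps)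
    qed (simp del: GL11_simps)
  next
    case (insert u V)
    have hv: "h v \<in> carrier (GL11 N)" if "v \<in> insert u V" for v using that insert.prems assms(3) by blast
    have "?r (insert u V) = (\<lambda>v. single_gauge (GL11 N) u (h u) v \<otimes>\<^bsub>GL11 N\<^esub> ?r V v)"
      using insert.hyps hv by (auto simp: single_gauge_def simp del: GL11_simps)
    then show ?case
      using realizable_gauge_mult[OF assms(1,2) realizable_single_gauge[OF assms(1,2) _ hv] insert.IH]
        insert.prems by simp
  qed
  from this[OF order_refl] show ?thesis
    using assms(3) G.gauge_act_cong[OF assms(1), of h "?r (vertices \<tau>)"]
    by (simp add: realizable_gauge_def del: GL11_simps)
qed

lemma gauge_equiv_chart_equiv:
  assumes "fatgraph \<tau>" "ori \<in> orientations \<tau>" "x \<in> chart N ori" "y \<in> chart N ori"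
    and "(chart_connection N \<tau> ori x, chart_connection N \<tau> ori y) \<in> gauge_equiv (GL11 N) \<tau>"
  shows "(x, y) \<in> chart_equiv N \<tau> ori"
proof -
  obtain h where "h \<in> vertices \<tau> \<rightarrow> carrier (GL11 N)"
    and y: "chart_connection N \<tau> ori y = gauge_act (GL11 N) \<tau> h (chart_connection N \<tau> ori x)"
    using assms(5) group.gauge_equiv_iff[OF GL11_group assms(1) chart_connection_closed[OF assms(1-3)]] by blast
  then obtain z where z: "(x, z) \<in> chart_equiv N \<tau> ori"
    "chart_connection N \<tau> ori z = chart_connection N \<tau> ori y"
    using realizable_gauge_all[OF assms(1,2)] assms(3) unfolding realizable_gauge_def by metis
  moreover from z(1) have "z \<in> chart N ori" by (simp add: chart_equiv_def)
  ultimately have "z = y"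
    using bij_betw_imp_inj_on[OF chart_connection_bij[OF assms(1,2)]] assms(4) by (meson inj_onD)
  then show ?thesis using z(1) by simp
qed

section \<open>Passing to the quotients\<close>

lemma bij_betw_quotients:
  assumes "equiv A R" "equiv B S" "bij_betw f A B"
    and rel: "\<And>x y. x \<in> A \<Longrightarrow> y \<in> A \<Longrightarrow> (x, y) \<in> R \<longleftrightarrow> (f x, f y) \<in> S"
  shows "bij_betw (\<lambda>C. S `` (f ` C)) (A // R) (B // S)"
    and "x \<in> A \<Longrightarrow> S `` (f ` (R `` {x})) = S `` {f x}"
proof -
  have fB: "f x \<in> B" if "x \<in> A" for x using assms(3) that by (rule bij_betw_apply)
  show cls: "S `` (f ` (R `` {x})) = S `` {f x}" if "x \<in> A" for x
  proof
    show "S `` {f x} \<subseteq> S `` (f ` (R `` {x}))" using equiv_class_self[OF assms(1) that] by blast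
    show "S `` (f ` (R `` {x})) \<subseteq> S `` {f x}"
    proof
      fix z assume "z \<in> S `` (f ` (R `` {x}))"
      then obtain y where y: "(x, y) \<in> R" "(f y, z) \<in> S" by blast
      then have "y \<in> A" using assms(1) by (auto simp: equiv_def)
      then show "z \<in> S `` {f x}" using rel[OF that] y assms(2) by (meson Image_singleton_iff equivE transD)
    qed
  qed
  show "bij_betw (\<lambda>C. S `` (f ` C)) (A // R) (B // S)"
  proof (rule bij_betw_imageI)
    show "inj_on (\<lambda>C. S `` (f ` C)) (A // R)"
    proof (rule inj_onI)
      fix C D assume "C \<in> A // R" "D \<in> A // R" and eq: "S `` (f ` C) = S `` (f ` D)"
      then obtain x y where xy: "x \<in> A" "y \<in> A" and C: "C = R `` {x}" and D: "D = R `` {y}"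
        by (auto elim!: quotientE)
      then have "(f x, f y) \<in> S" using eq cls fB eq_equiv_class_iff[OF assms(2)] by auto
      then show "C = D" using rel xy eq_equiv_class_iff[OF assms(1)] C D by blast
    qed
    show "(\<lambda>C. S `` (f ` C)) ` (A // R) = B // S"
    proof
      show "(\<lambda>C. S `` (f ` C)) ` (A // R) \<subseteq> B // S"
      proof (rule image_subsetI)
        fix C assume "C \<in> A // R"
        then obtain x where "x \<in> A" "C = R `` {x}" by (rule quotientE)
        then show "S `` (f ` C) \<in> B // S" using cls quotientI[OF fB] by simp
      qed
      show "B // S \<subseteq> (\<lambda>C. S `` (f ` C)) ` (A // R)"
      proof
        fix D assume "D \<in> B // S"
        then obtain y where "y \<in> B" "D = S `` {y}" by (rule quotientE)
        then obtain x where "x \<in> A" "D = S `` {f x}"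
          using bij_betw_imp_surj_on[OF assms(3)] by blast
        then show "D \<in> (\<lambda>C. S `` (f ` C)) ` (A // R)"
          using cls quotientI[of x A R] by (metis image_eqI)
      qed
    qed
  qed
qed

theorem theorem3:
  fixes N g s :: nat and \<tau> :: "'e fatgraph" and ori :: "'e set"
  assumes "s \<ge> 1" and "2 * int g - 2 + int s > 0"
    and "fatgraph_of_surface g s \<tau>" and "trivalent \<tau>"
    and "ori \<in> orientations \<tau>"
  shows "\<exists>\<Phi>. bij_betw \<Phi> (coordinate_space N \<tau> ori) (moduli (GL11 N) \<tau>) \<and>
    (\<forall>x\<in>chart N ori. \<Phi> (chart_equiv N \<tau> ori `` {x}) =
      gauge_equiv (GL11 N) \<tau> `` {chart_connection N \<tau> ori x})"
proof -
  have fat: "fatgraph \<tau>" using assms(3) by (simp add: fatgraph_of_surface_def)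
  have rel: "(x, y) \<in> chart_equiv N \<tau> ori \<longleftrightarrow>
      (chart_connection N \<tau> ori x, chart_connection N \<tau> ori y) \<in> gauge_equiv (GL11 N) \<tau>"
    if "x \<in> chart N ori" "y \<in> chart N ori" for x y
    using chart_equiv_gauge_equiv[OF fat assms(5)] gauge_equiv_chart_equiv[OF fat assms(5) that] by blast
  note quot = bij_betw_quotients[OF chart_equiv_equiv group.gauge_equiv_equiv[OF GL11_group fat]
      chart_connection_bij[OF fat assms(5)] rel]
  show ?thesis
    unfolding coordinate_space_def moduli_def
    using quot by (intro exI conjI ballI) blast+
qed

end
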